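(* Let $n\ge 2$. There exists a constant $c_n$ depending only on $n$ such that the following holds. Let $0<\alpha<1$, let $w\in A_1$, and suppose that $\Omega$ is homogeneous of degree zero on $\mathbb{R}^n\setminus\{0\}$, has zero average on $\mathbb{S}^{n-1}$, and belongs to $L^{\frac{n}{\alpha},\infty}(\mathbb{S}^{n-1})$. Then for every smooth function $f$ on $\mathbb{R}^n$ with compact support and every $x\in\mathbb{R}^n$, $$T^\star_\Omega f(x)\le c_n\,(1-\alpha)\,\|\Omega\|_{L^{\frac{n}{\alpha},\infty}(\mathbb{S}^{n-1})}\,[w]_{A_1}\,T_{w,\alpha}(\mathcal{D}^\alpha f)(x).$$
   Context: A weight is a non-negative locally integrable function $w$ on $\mathbb{R}^n$, not identically zero; for a ball $B$ write $w(B)=\int_B w(x)\,dx$. The weight $w$ is in the class $A_1$ if there is a constant $C$ such that for every ball $B$, $\frac{1}{|B|}\int_B w(z)\,dz\le C\,w(x)$ for almost every $x\in B$; the least such $C$ is denoted $[w]_{A_1}$. $B(x,r)$ is the Euclidean ball with center $x$ and radius $r$. For $0<\alpha<n$, $$T_{w,\alpha}f(x)=\int_{\mathbb{R}^n}\frac{|x-y|^\alpha}{w(B(x,|x-y|))}\,f(y)\,w(y)\,dy$$ (for non-negative $f$ the value may be $+\infty$). The nonlinear fractional differential operator is, for $0<\alpha<1$, $$\mathcal{D}^\alpha f(x)=\int_{\mathbb{R}^n}\frac{|f(x)-f(y)|}{|x-y|^{n+\alpha}}\,dy.$$ The maximal truncated rough singular integral is $$T^\star_\Omega f(x)=\sup_{t>0}\left|\int_{|y|>t}\frac{\Omega(y)}{|y|^n}f(x-y)\,dy\right|.$$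 Homogeneous of degree zero means $\Omega(\lambda y)=\Omega(y)$ for all $\lambda>0$, $y\neq0$; zero average means $\int_{\mathbb{S}^{n-1}}\Omega\,d\sigma=0$, where $\sigma$ is surface measure on the unit sphere $\mathbb{S}^{n-1}$. For $0<p<\infty$, $\|\Omega\|_{L^{p,\infty}(\mathbb{S}^{n-1})}=\sup_{t>0}t\,\sigma(\{\theta\in\mathbb{S}^{n-1}:|\Omega(\theta)|>t\})^{1/p}$, and $L^{p,\infty}(\mathbb{S}^{n-1})$ is the set of functions for which this is finite. *)

theory Defs
  imports "HOL-Analysis.Analysis"
begin

subsection \<open>Surface measure and weak Lebesgue spaces on the unit sphere\<close>

text \<open>
  Surface measure on the unit sphere of an \<open>n\<close>-dimensional space is given by the volume of cones,
  \<open>\<sigma>(A) = n \<cdot> |{r\<theta> : 0 < r < 1, \<theta> \<in> A}|\<close>. It is completed, so that the measurable functions on the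
  sphere are those corresponding to Lebesgue measurable functions on the whole space that are
  homogeneous of degree zero.
\<close>

definition sphere_measure :: "'a::euclidean_space measure" where
  "sphere_measure =
     completion
       (scale_measure (of_nat DIM('a))
         (distr (restrict_space lborel (ball 0 1 - {0})) (restrict_space borel (sphere 0 1))
            (\<lambda>x. x /\<^sub>R norm x)))"

lemma emeasure_sphere_measure:
  fixes A :: "'a::euclidean_space set"
  assumes A: "A \<in> sets borel" "A \<subseteq> sphere 0 1"
  shows "emeasure sphere_measure A =
    of_nat DIM('a) * emeasure lborel {x \<in> ball 0 1 - {0}. x /\<^sub>R norm x \<in> A}"
proof -
  let ?M = "restrict_space lborel (ball 0 1 - {0::'a})"
  let ?N = "restrict_space borel (sphere (0::'a) 1)"
  let ?g = "\<lambda>x::'a. x /\<^sub>R norm x"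
  have "continuous_on (ball 0 1 - {0}) ?g"
    by (intro continuous_intros) auto
  then have "?g \<in> borel_measurable (restrict_space borel (ball 0 1 - {0::'a}))"
    by (rule borel_measurable_continuous_on_restrict)
  then have g: "?g \<in> ?M \<rightarrow>\<^sub>M ?N"
    by (intro measurable_restrict_space2)
       (auto simp: space_restrict_space cong: measurable_cong_sets sets_restrict_space_cong)
  have AN: "A \<in> sets ?N"
    using A by (simp add: sets_restrict_space_iff)
  have "emeasure (sphere_measure :: 'a measure) A
      = of_nat DIM('a) * emeasure ?M (?g -` A \<inter> space ?M)"
    unfolding sphere_measure_def
    using AN by (simp add: emeasure_distr[OF g])
  also have "?g -` A \<inter> space ?M = {x \<in> ball 0 1 - {0}. ?g x \<in> A}"
    by (auto simp: space_restrict_space)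
  also have "emeasure ?M \<dots> = emeasure lborel {x \<in> ball 0 1 - {0}. ?g x \<in> A}"
    by (rule emeasure_restrict_space) auto
  finally show ?thesis .
qed

definition weak_Lp_norm :: "real \<Rightarrow> ('a::euclidean_space \<Rightarrow> real) \<Rightarrow> ennreal" where
  "weak_Lp_norm p \<Omega> =
     (SUP t\<in>{0<..}. ennreal (t * measure sphere_measure {\<theta>\<in>sphere 0 1. \<bar>\<Omega> \<theta>\<bar> > t} powr (1 / p)))"

definition in_weak_Lp :: "real \<Rightarrow> ('a::euclidean_space \<Rightarrow> real) \<Rightarrow> bool" where
  "in_weak_Lp p \<Omega> \<longleftrightarrow> \<Omega> \<in> borel_measurable sphere_measure \<and> weak_Lp_norm p \<Omega> < \<infinity>"

text \<open>The value at the origin is irrelevant.\<close>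

definition homogeneous_deg0 :: "('a::real_vector \<Rightarrow> real) \<Rightarrow> bool" where
  "homogeneous_deg0 \<Omega> \<longleftrightarrow> (\<forall>r>0. \<forall>y. y \<noteq> 0 \<longrightarrow> \<Omega> (r *\<^sub>R y) = \<Omega> y)"

definition zero_average :: "('a::euclidean_space \<Rightarrow> real) \<Rightarrow> bool" where
  "zero_average \<Omega> \<longleftrightarrow> (LINT \<theta>|sphere_measure. \<Omega> \<theta>) = 0"


subsection \<open>Muckenhoupt weights\<close>

text \<open>
  As usual for weights, not being identically zero is understood up to null sets. Local
  integrability includes Lebesgue measurability.
\<close>

definition weight :: "('a::euclidean_space \<Rightarrow> real) \<Rightarrow> bool" where
  "weight w \<longleftrightarrow> (\<forall>x. 0 \<le> w x) \<and> (\<forall>K. compact K \<longrightarrow> set_integrable lebesgue K w) \<and>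
     \<not> (AE x in lebesgue. w x = 0)"

definition weight_measure :: "('a::euclidean_space \<Rightarrow> real) \<Rightarrow> 'a set \<Rightarrow> real" where
  "weight_measure w B = (LINT x:B|lebesgue. w x)"

definition A1_bound :: "('a::euclidean_space \<Rightarrow> real) \<Rightarrow> real \<Rightarrow> bool" where
  "A1_bound w C \<longleftrightarrow>
     (\<forall>z r. 0 < r \<longrightarrow>
        (AE x in lebesgue. x \<in> ball z r \<longrightarrow>
           weight_measure w (ball z r) / measure lebesgue (ball z r) \<le> C * w x))"

definition A1_weight :: "('a::euclidean_space \<Rightarrow> real) \<Rightarrow> bool" where
  "A1_weight w \<longleftrightarrow> weight w \<and> (\<exists>C. A1_bound w C)"

definition A1_const :: "('a::euclidean_space \<Rightarrow> real) \<Rightarrow> real" where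
  "A1_const w = Inf {C. A1_bound w C}"

text \<open>The infimum is a minimum.\<close>

lemma A1_bound_pos:
  fixes w :: "'a::euclidean_space \<Rightarrow> real"
  assumes w: "weight w" and C: "A1_bound w C"
  shows "0 < C"
proof (rule ccontr)
  assume "\<not> 0 < C"
  then have le: "C * w x \<le> 0" for x
    using w by (simp add: weight_def mult_nonpos_nonneg)
  have "AE x in lebesgue. x \<in> ball 0 (real (Suc k)) \<longrightarrow> w x = 0" for k
  proof -
    let ?B = "ball (0::'a) (real (Suc k))"
    have "AE x in lebesgue. x \<in> ?B \<longrightarrow>
        weight_measure w ?B / measure lebesgue ?B \<le> C * w x"
      using C[unfolded A1_bound_def, rule_format, of "real (Suc k)" 0] by simp
    then have ae: "AE x in lebesgue. x \<in> ?B \<longrightarrow>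
        weight_measure w ?B / measure lebesgue ?B \<le> 0"
      by eventually_elim (use le order_trans in blast)
    have mB: "measure lebesgue ?B > 0"
      by (simp add: content_ball_pos)
    have "weight_measure w ?B / measure lebesgue ?B \<le> 0"
    proof (rule ccontr)
      assume "\<not> ?thesis"
      then have "AE x in lebesgue. x \<notin> ?B"
        using ae by (auto elim: eventually_mono)
      then have "?B \<in> null_sets lebesgue"
        using AE_iff_null_sets[of ?B lebesgue] by simp
      then show False using mB by (auto simp: null_sets_def measure_def)
    qed
    with mB have I: "weight_measure w ?B \<le> 0"
      unfolding divide_le_0_iff by linarith
    have "set_integrable lebesgue (cball (0::'a) (real (Suc k))) w"
      using w by (simp add: weight_def)
    then have int: "set_integrable lebesgue ?B w"
      by (rule set_integrable_subset) auto
    have nn: "AE x in lebesgue. 0 \<le> indicat_real ?B x *\<^sub>R w x"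
      using w by (simp add: weight_def)
    have "(LINT x|lebesgue. indicat_real ?B x *\<^sub>R w x) = 0"
      using I integral_nonneg_AE[OF nn]
      by (simp add: weight_measure_def set_lebesgue_integral_def)
    then have "AE x in lebesgue. indicat_real ?B x *\<^sub>R w x = 0"
      using integral_nonneg_eq_0_iff_AE[OF _ nn] int by (simp add: set_integrable_def)
    then show ?thesis
      by eventually_elim (simp add: indicator_def)
  qed
  then have "AE x in lebesgue. \<forall>k. x \<in> ball 0 (real (Suc k)) \<longrightarrow> w x = 0"
    unfolding AE_all_countable by blast
  then have "AE x in lebesgue. w x = 0"
  proof eventually_elim
    case (elim x)
    obtain k where "norm x < real k" using reals_Archimedean2 by blast
    then have "x \<in> ball 0 (real (Suc k))" by simp
    with elim show ?case by blast
  qed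
  with w show False by (simp add: weight_def)
qed

lemma A1_const_least:
  assumes "A1_weight w"
  shows "A1_bound w (A1_const w)" and "A1_bound w C \<Longrightarrow> A1_const w \<le> C"
proof -
  have w: "weight w" and ne: "{C. A1_bound w C} \<noteq> {}"
    using assms by (auto simp: A1_weight_def)
  have bb: "bdd_below {C. A1_bound w C}"
    using A1_bound_pos[OF w] by (intro bdd_belowI[of _ 0]) (simp add: less_imp_le)
  show "A1_const w \<le> C" if "A1_bound w C"
    unfolding A1_const_def by (rule cInf_lower) (use that bb in auto)
  have approx: "\<exists>C. A1_bound w C \<and> C < A1_const w + 1 / real (Suc k)" for k
    using cInf_less_iff[OF ne bb, of "A1_const w + 1 / real (Suc k)"]
    by (auto simp: A1_const_def)
  then obtain c where c: "\<And>k. A1_bound w (c k)" "\<And>k. c k < A1_const w + 1 / real (Suc k)"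
    by metis
  show "A1_bound w (A1_const w)"
    unfolding A1_bound_def
  proof (intro allI impI)
    fix z and r :: real assume r: "0 < r"
    let ?a = "weight_measure w (ball z r) / measure lebesgue (ball z r)"
    have "AE x in lebesgue. \<forall>k. x \<in> ball z r \<longrightarrow> ?a \<le> c k * w x"
      using c(1) r unfolding A1_bound_def AE_all_countable by blast
    then show "AE x in lebesgue. x \<in> ball z r \<longrightarrow> ?a \<le> A1_const w * w x"
    proof eventually_elim
      case (elim x)
      show ?case
      proof
        assume x: "x \<in> ball z r"
        have wx: "0 \<le> w x" using w by (simp add: weight_def)
        have "?a \<le> (A1_const w + 1 / real (Suc k)) * w x" for k
        proof -
          have "?a \<le> c k * w x" using elim x by blast
          also have "\<dots> \<le> (A1_const w + 1 / real (Suc k)) * w x"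
            using c(2)[of k] wx by (intro mult_right_mono) auto
          finally show ?thesis .
        qed
        moreover have "(\<lambda>k. (A1_const w + 1 / real (Suc k)) * w x)
            \<longlonglongrightarrow> (A1_const w + 0) * w x"
          by (intro tendsto_intros LIMSEQ_Suc[OF lim_1_over_n])
        ultimately show "?a \<le> A1_const w * w x"
          by (intro LIMSEQ_le_const) auto
      qed
    qed
  qed
qed


subsection \<open>Smooth functions with compact support\<close>

primrec C_diff :: "nat \<Rightarrow> ('a::euclidean_space \<Rightarrow> real) \<Rightarrow> bool" where
  "C_diff 0 f \<longleftrightarrow> continuous_on UNIV f"
| "C_diff (Suc k) f \<longleftrightarrow>
     (\<forall>x. f differentiable (at x)) \<and>
     (\<forall>b\<in>Basis. C_diff k (\<lambda>x. frechet_derivative f (at x) b))"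

definition smooth_compact_support :: "('a::euclidean_space \<Rightarrow> real) \<Rightarrow> bool" where
  "smooth_compact_support f \<longleftrightarrow> (\<forall>k. C_diff k f) \<and> compact (closure {x. f x \<noteq> 0})"


subsection \<open>The operators\<close>

definition T_weight ::
    "('a::euclidean_space \<Rightarrow> real) \<Rightarrow> real \<Rightarrow> ('a \<Rightarrow> ennreal) \<Rightarrow> 'a \<Rightarrow> ennreal" where
  "T_weight w \<alpha> f x =
     (\<integral>\<^sup>+y. ennreal (norm (x - y) powr \<alpha> / weight_measure w (ball x (norm (x - y)))) * f y
             * ennreal (w y) \<partial>lebesgue)"

definition frac_diff :: "real \<Rightarrow> ('a::euclidean_space \<Rightarrow> real) \<Rightarrow> 'a \<Rightarrow> ennreal" where
  "frac_diff \<alpha> f x =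
     (\<integral>\<^sup>+y. ennreal (\<bar>f x - f y\<bar> / norm (x - y) powr (real DIM('a) + \<alpha>)) \<partial>lebesgue)"

definition T_star :: "('a::euclidean_space \<Rightarrow> real) \<Rightarrow> ('a \<Rightarrow> real) \<Rightarrow> 'a \<Rightarrow> ennreal" where
  "T_star \<Omega> f x =
     (SUP t\<in>{0<..}. ennreal \<bar>LINT y:{y. norm y > t}|lebesgue. \<Omega> y / norm y ^ DIM('a) * f (x - y)\<bar>)"

end

theory Submission
  imports Defs
begin

text \<open>
  Fix \<open>x\<close> and put \<open>g y = f (x - y)\<close> and \<open>B s = ball 0 s\<close>; \<open>n\<close> is the dimension and \<open>N\<close> is the weak
  \<open>L\<^sup>p\<close> norm of \<open>\<Omega>\<close> for \<open>p = n / \<alpha>\<close>. The proof reduces everything to sets by two layer-cake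
  decompositions and then plays the weak integrability of the kernel against a relative isoperimetric
  inequality.

  Since \<open>|y| powr - n\<close> is the integral of \<open>n * s powr (- n - 1)\<close> over \<open>s > |y|\<close>, the truncated singular
  integral is an average, over radii \<open>s\<close>, of the integrals of \<open>\<Omega> * g\<close> over the shells
  \<open>t < |y| < s\<close>. Writing \<open>g\<close> as a superposition of indicators of its superlevel sets reduces each of
  these to the integral of \<open>\<Omega>\<close> over the part of the shell inside a set \<open>E\<close>
  (\<open>abs_integral_layer_le\<close> performs both reductions). As \<open>\<Omega>\<close> has mean zero on every shell, \<open>E\<close> may be
  replaced by its complement, and the weak bound on \<open>\<Omega>\<close> gives at most
  \<open>2 * N * s powr \<alpha> * m powr (1 - \<alpha> / n)\<close>, with \<open>m\<close> the smaller of the measures of \<open>B s \<inter> E\<close> and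
  \<open>B s - E\<close> (\<open>set_nn_integral_kernel_le\<close>).

  The power \<open>m powr (1 - \<alpha> / n)\<close> is exactly what the relative fractional isoperimetric inequality
  controls (\<open>relative_fractional_isoperimetric\<close>): it is at most a dimensional constant times
  \<open>(1 - \<alpha>)\<close> times the integral of \<open>\<D>\<^sup>\<alpha> 1\<^sub>E\<close> over \<open>B (3 * s)\<close>. The factor \<open>1 - \<alpha>\<close> comes from
  subadditivity: a shift by \<open>h\<close> can be made in \<open>2 ^ k\<close> steps of length \<open>|h| / 2 ^ k\<close>, so the
  shifts \<open>2 ^ k\<close> times shorter contribute to the integral of \<open>\<D>\<^sup>\<alpha> 1\<^sub>E\<close> at least
  \<open>2 powr (k * (\<alpha> - 1))\<close> times what the shifts of the original length contribute, and the geometric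
  series sums to at least \<open>1 / (1 - \<alpha>)\<close>.

  Integrating back over the levels of \<open>g\<close> turns \<open>\<D>\<^sup>\<alpha> 1\<^sub>E\<close> into \<open>\<D>\<^sup>\<alpha> g\<close> by the coarea formula, and
  integrating over \<open>s\<close> produces the Riesz potential of \<open>\<D>\<^sup>\<alpha> g\<close> at the origin
  (\<open>abs_truncated_integral_le_riesz_potential\<close>); here \<open>n / (n - \<alpha>) \<le> 2\<close> because \<open>n \<ge> 2\<close>. Finally the
  \<open>A\<^sub>1\<close> condition on balls whose boundary passes through \<open>y\<close> says that \<open>|x - y| powr - n\<close> is at most
  \<open>[w]\<close> times the volume of the unit ball times \<open>w y / w(B(x,|x - y|))\<close>, so that the Riesz potential is
  dominated by \<open>T_weight\<close> (\<open>riesz_potential_le_T_weight\<close>).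
\<close>

section \<open>Changes of variables for Lebesgue measure\<close>

lemma nn_integral_lborel_translate:
  fixes f :: "'a::euclidean_space \<Rightarrow> ennreal"
  assumes [measurable]: "f \<in> borel_measurable borel"
  shows "(\<integral>\<^sup>+x. f (c + x) \<partial>lborel) = (\<integral>\<^sup>+x. f x \<partial>lborel)"
proof -
  have "(\<integral>\<^sup>+x. f x \<partial>lborel) = (\<integral>\<^sup>+x. f x \<partial>distr lborel borel ((+) c))"
    by (simp add: lborel_distr_plus)
  also have "\<dots> = (\<integral>\<^sup>+x. f (c + x) \<partial>lborel)"
    by (subst nn_integral_distr) auto
  finally show ?thesis ..
qed

lemma nn_integral_lborel_scale:
  fixes f :: "'a::euclidean_space \<Rightarrow> ennreal"
  assumes [measurable]: "f \<in> borel_measurable borel" and c: "c \<noteq> 0"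
  shows "(\<integral>\<^sup>+x. f x \<partial>lborel) = ennreal (\<bar>c\<bar> ^ DIM('a)) * (\<integral>\<^sup>+x. f (c *\<^sub>R x) \<partial>lborel)"
proof -
  have "(\<integral>\<^sup>+x. f x \<partial>lborel)
      = (\<integral>\<^sup>+x. f x \<partial>density (distr lborel borel (\<lambda>x. 0 + c *\<^sub>R x)) (\<lambda>_. ennreal (\<bar>c\<bar> ^ DIM('a))))"
    by (subst lborel_affine[OF c, of 0]) (simp add: ennreal_power)
  also have "\<dots> = ennreal (\<bar>c\<bar> ^ DIM('a)) * (\<integral>\<^sup>+x. f (c *\<^sub>R x) \<partial>lborel)"
    by (simp add: nn_integral_density nn_integral_distr nn_integral_cmult)
  finally show ?thesis .
qed

lemma nn_integral_lborel_reflect: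
  fixes f :: "'a::euclidean_space \<Rightarrow> ennreal"
  assumes [measurable]: "f \<in> borel_measurable borel"
  shows "(\<integral>\<^sup>+y. f (x - y) \<partial>lborel) = (\<integral>\<^sup>+y. f y \<partial>lborel)"
proof -
  have "(\<integral>\<^sup>+y. f y \<partial>lborel) = (\<integral>\<^sup>+y. f (- y) \<partial>lborel)"
    using nn_integral_lborel_scale[of f "- 1"] by simp
  also have "\<dots> = (\<integral>\<^sup>+y. f (- (- x + y)) \<partial>lborel)"
    by (rule nn_integral_lborel_translate[symmetric]) measurable
  finally show ?thesis by simp
qed

lemma lborel_integral_scale:
  fixes f :: "'a::euclidean_space \<Rightarrow> real"
  assumes [measurable]: "f \<in> borel_measurable borel" and c: "c \<noteq> 0"
  shows "(\<integral>x. f x \<partial>lborel) = \<bar>c\<bar> ^ DIM('a) * (\<integral>x. f (c *\<^sub>R x) \<partial>lborel)"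
proof -
  have "(\<integral>x. f x \<partial>lborel)
      = (\<integral>x. f x \<partial>density (distr lborel borel (\<lambda>x. 0 + c *\<^sub>R x)) (\<lambda>_. ennreal (\<bar>c\<bar> ^ DIM('a))))"
    by (subst lborel_affine[OF c, of 0]) (simp add: ennreal_power)
  also have "\<dots> = \<bar>c\<bar> ^ DIM('a) * (\<integral>x. f (c *\<^sub>R x) \<partial>lborel)"
    by (subst integral_density) (auto simp: integral_distr)
  finally show ?thesis .
qed

lemma AE_lborel_norm_neq: "AE y in lborel. norm (y::'a::euclidean_space) \<noteq> t"
proof -
  have "sphere (0::'a) t \<in> null_sets lebesgue"
    using negligible_sphere by (simp add: negligible_iff_null_sets)
  then have "sphere (0::'a) t \<in> null_sets lborel"
    by (subst (asm) null_sets_completion_iff) auto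
  from AE_not_in[OF this] show ?thesis by eventually_elim simp
qed

lemma measurable_lborel_pair:
  assumes "f \<in> borel_measurable (borel \<Otimes>\<^sub>M borel)"
  shows "f \<in> borel_measurable (lborel \<Otimes>\<^sub>M lborel)"
proof -
  have "sets (lborel \<Otimes>\<^sub>M lborel) = sets (borel \<Otimes>\<^sub>M borel)"
    by (intro sets_pair_measure_cong) simp_all
  with assms show ?thesis by (simp cong: measurable_cong_sets)
qed

section \<open>How much of a set is moved across its boundary by a shift\<close>

text \<open>
  The \<open>L\<^sup>1\<close> modulus of continuity of the indicator of \<open>E\<close>, localized to base points in a ball.
  The localization makes the isoperimetric inequality below a relative one.
\<close>
definition shift_jump :: "'a::euclidean_space set \<Rightarrow> real \<Rightarrow> 'a \<Rightarrow> ennreal" where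
  "shift_jump E r h = emeasure lborel {y \<in> ball 0 r. (y \<in> E) \<noteq> (y + h \<in> E)}"

text \<open>
  If \<open>y\<close> and \<open>y + h + k\<close> lie on different sides of \<open>E\<close>, then the side changes on one of the two legs
  of the path through \<open>y + h\<close>. The second leg starts outside the ball by at most \<open>|h|\<close>, which is why
  the radius grows.
\<close>
lemma shift_jump_add:
  fixes E :: "'a::euclidean_space set"
  assumes [measurable]: "E \<in> sets borel"
  shows "shift_jump E r (h + k) \<le> shift_jump E r h + shift_jump E (r + norm h) k"
proof -
  let ?J = "\<lambda>r h. {y \<in> ball 0 r. (y \<in> E) \<noteq> (y + h \<in> E)}"
  have meas [measurable]: "?J r h \<in> sets borel" for r h
    by measurable
  have "?J r (h + k) \<subseteq> ?J r h \<union> (\<lambda>y. h + y) -` ?J (r + norm h) k"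
  proof
    fix y assume y: "y \<in> ?J r (h + k)"
    have "norm (h + y) < r + norm h"
      using y norm_triangle_ineq[of h y] by simp
    with y show "y \<in> ?J r h \<union> (\<lambda>y. h + y) -` ?J (r + norm h) k"
      by (auto simp: add_ac)
  qed
  then have "shift_jump E r (h + k) \<le> emeasure lborel (?J r h \<union> (\<lambda>y. h + y) -` ?J (r + norm h) k)"
    unfolding shift_jump_def by (intro emeasure_mono) (auto intro!: measurable_sets_borel[OF _ meas])
  also have "\<dots> \<le> emeasure lborel (?J r h) + emeasure lborel ((\<lambda>y. h + y) -` ?J (r + norm h) k)"
    by (intro emeasure_subadditive) (auto intro!: measurable_sets_borel[OF _ meas])
  also have "emeasure lborel ((\<lambda>y. h + y) -` ?J (r + norm h) k)
      = emeasure (distr lborel borel ((+) h)) (?J (r + norm h) k)"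
    by (subst emeasure_distr) auto
  finally show ?thesis by (simp add: shift_jump_def lborel_distr_plus)
qed

lemma shift_jump_mono:
  fixes E :: "'a::euclidean_space set"
  assumes [measurable]: "E \<in> sets borel" and "r \<le> r'"
  shows "shift_jump E r h \<le> shift_jump E r' h"
  unfolding shift_jump_def
proof (rule emeasure_mono)
  show "{y \<in> ball 0 r'. (y \<in> E) \<noteq> (y + h \<in> E)} \<in> sets lborel" by measurable
qed (use assms in auto)

text \<open>
  Repeated doubling. The radii accumulate to \<open>r + 2 ^ k * |h|\<close> only, so that one fixed enlarged ball
  serves all dyadic scales below a given one.
\<close>
lemma shift_jump_power2:
  fixes E :: "'a::euclidean_space set"
  assumes E: "E \<in> sets borel"
  shows "shift_jump E r (2 ^ k *\<^sub>R h) \<le> 2 ^ k * shift_jump E (r + 2 ^ k * norm h) h"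
proof (induction k arbitrary: r)
  case 0
  show ?case using shift_jump_mono[OF E, of r "r + norm h" h] by simp
next
  case (Suc k)
  let ?h = "2 ^ k *\<^sub>R h"
  have "2 ^ Suc k *\<^sub>R h = ?h + ?h" by (simp add: scaleR_add_left[symmetric])
  then have "shift_jump E r (2 ^ Suc k *\<^sub>R h) \<le> shift_jump E r ?h + shift_jump E (r + norm ?h) ?h"
    using shift_jump_add[OF E, of r ?h ?h] by simp
  also have "\<dots> \<le> shift_jump E (r + norm ?h) ?h + shift_jump E (r + norm ?h) ?h"
    by (intro add_right_mono shift_jump_mono E) simp
  also have "\<dots> = 2 * shift_jump E (r + norm ?h) ?h" by (simp add: mult_2)
  also have "\<dots> \<le> 2 * (2 ^ k * shift_jump E ((r + norm ?h) + 2 ^ k * norm h) h)"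
    by (intro mult_left_mono Suc.IH) auto
  also have "(r + norm ?h) + 2 ^ k * norm h = r + 2 ^ Suc k * norm h" by simp
  finally show ?case by (simp add: mult_ac)
qed

lemma shift_jump_nn_integral:
  fixes E :: "'a::euclidean_space set"
  assumes [measurable]: "E \<in> sets borel"
  shows "shift_jump E r h
    = (\<integral>\<^sup>+y. (if norm y < r \<and> (y \<in> E) \<noteq> (y + h \<in> E) then 1 else 0) \<partial>lborel)"
proof -
  have "shift_jump E r h = (\<integral>\<^sup>+y. indicator {y \<in> ball 0 r. (y \<in> E) \<noteq> (y + h \<in> E)} y \<partial>lborel)"
    unfolding shift_jump_def by (rule nn_integral_indicator[symmetric]) measurable
  also have "\<dots> = (\<integral>\<^sup>+y. (if norm y < r \<and> (y \<in> E) \<noteq> (y + h \<in> E) then 1 else 0) \<partial>lborel)"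
    by (intro nn_integral_cong) (auto simp: indicator_def)
  finally show ?thesis .
qed

lemma measurable_shift_jump [measurable]:
  fixes E :: "'a::euclidean_space set"
  assumes [measurable]: "E \<in> sets borel"
  shows "shift_jump E r \<in> borel_measurable borel"
proof -
  have "(\<lambda>h. \<integral>\<^sup>+y. (if norm y < r \<and> (y \<in> E) \<noteq> (y + h \<in> E) then 1 else 0) \<partial>lborel)
    \<in> borel_measurable (borel :: 'a measure)"
    by measurable
  then show ?thesis by (simp add: shift_jump_nn_integral[OF assms, abs_def])
qed

text \<open>
  A geometric sum with ratio at least \<open>2\<close> is at most twice its last term.
\<close>
lemma sum_dyadic_powr_le:
  fixes x \<beta> :: real
  assumes "1 \<le> \<beta>" "0 < x"
  shows "(\<Sum>k<K. if 2 ^ k < x then (2 powr \<beta>) ^ k else 0) \<le> 2 * x powr \<beta>"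
proof (induction K)
  case (Suc K)
  show ?case
  proof (cases "2 ^ K < x")
    case False
    with Suc show ?thesis by simp
  next
    case True
    define q where "q = 2 powr \<beta>"
    have q: "2 \<le> q" using powr_mono[of 1 \<beta> "2::real"] assms by (simp add: q_def)
    have geo: "(\<Sum>k<K. q ^ k) \<le> q ^ K"
    proof (induction K)
      case (Suc K)
      have "q ^ K + q ^ K \<le> q * q ^ K" using q by simp
      with Suc show ?case by simp
    qed simp
    have "(\<Sum>k<K. if 2 ^ k < x then q ^ k else 0) \<le> (\<Sum>k<K. q ^ k)"
      by (intro sum_mono) (use q in auto)
    also note geo
    finally have "(\<Sum>k<Suc K. if 2 ^ k < x then q ^ k else 0) \<le> 2 * q ^ K"
      using True by simp
    also have "q ^ K = (2 ^ K) powr \<beta>"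
      by (simp add: q_def powr_powr powr_realpow[symmetric] mult.commute)
    also have "\<dots> \<le> x powr \<beta>" using True assms by (intro powr_mono2) auto
    finally show ?thesis unfolding q_def by simp
  qed
qed (use assms in simp)

lemma one_minus_le_geometric_2_powr:
  fixes \<alpha> :: real
  assumes "\<alpha> < 1"
  shows "1 / (1 - \<alpha>) \<le> 1 / (1 - 2 powr (\<alpha> - 1))"
proof -
  have "2 powr (\<alpha> - 1) = exp ((\<alpha> - 1) * ln 2)" by (simp add: powr_def)
  also have "\<dots> \<ge> 1 + (\<alpha> - 1) * ln 2" by (rule exp_ge_add_one_self)
  finally have "1 - 2 powr (\<alpha> - 1) \<le> (1 - \<alpha>) * ln 2" by (simp add: algebra_simps)
  also have "\<dots> \<le> (1 - \<alpha>) * 1" using assms ln_le_minus_one[of 2] by (intro mult_left_mono) auto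
  finally have "1 - 2 powr (\<alpha> - 1) \<le> 1 - \<alpha>" by simp
  moreover have "2 powr (\<alpha> - 1) < 2 powr 0" using assms by (subst powr_less_cancel_iff) auto
  ultimately show ?thesis using assms by (intro divide_left_mono) auto
qed

text \<open>
  The source of the factor \<open>1 - \<alpha>\<close>. After rescaling, the average over shifts of length below \<open>\<rho>\<close> is
  at most \<open>2 ^ k\<close> times the average over shifts of length below \<open>\<rho> / 2 ^ k\<close>, for every \<open>k\<close>. Weighting
  these inequalities by \<open>2 powr (k * (\<alpha> - 1))\<close> and adding them, the left-hand side picks up a
  geometric series which is at least \<open>1 / (1 - \<alpha>)\<close>, while on the right the dyadic indicators sum to
  at most twice the kernel \<open>(\<rho> / |h|) powr (n + \<alpha>)\<close>.
\<close>
lemma shift_jump_average_le: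
  fixes E :: "'a::euclidean_space set"
  assumes E [measurable]: "E \<in> sets borel" and \<alpha>: "0 < \<alpha>" "\<alpha> < 1" and \<rho>: "0 < \<rho>"
  defines "\<beta> \<equiv> real DIM('a) + \<alpha>"
  shows "(\<integral>\<^sup>+h\<in>ball 0 \<rho>. shift_jump E r h \<partial>lborel)
    \<le> ennreal (2 * (1 - \<alpha>) * \<rho> powr \<beta>) *
       (\<integral>\<^sup>+h\<in>ball 0 \<rho>. shift_jump E (r + \<rho>) h * ennreal (1 / norm h powr \<beta>) \<partial>lborel)"
    (is "?L \<le> ennreal ?c * ?R")
proof -
  let ?W = "shift_jump E (r + \<rho>)"
  note [measurable] = measurable_shift_jump[OF E]
  define d q :: real where "d = 2 powr (\<alpha> - 1)" and "q = 2 powr \<beta>"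
  have d: "0 < d" "d < 1" 
    using \<alpha> powr_less_cancel_iff[of 2 "\<alpha> - 1" 0] by (auto simp: d_def)
  have \<beta>: "1 \<le> \<beta>" using \<alpha> DIM_positive[where 'a='a] unfolding \<beta>_def by linarith
  have step: "ennreal (d ^ k) * ?L
      \<le> (\<integral>\<^sup>+h. ennreal (if 2 ^ k < \<rho> / norm h then q ^ k else 0) * ?W h \<partial>lborel)" for k
  proof -
    let ?B = "ball (0::'a) \<rho>"
    have "?L = ennreal ((2 ^ k) ^ DIM('a)) *
        (\<integral>\<^sup>+h. shift_jump E r (2 ^ k *\<^sub>R h) * indicator ?B (2 ^ k *\<^sub>R h) \<partial>lborel)"
      by (subst nn_integral_lborel_scale[of _ "2 ^ k"]) (measurable, auto)
    also have "\<dots> \<le> ennreal ((2 ^ k) ^ DIM('a)) *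
        (\<integral>\<^sup>+h. ennreal (2 ^ k) * (?W h * indicator ?B (2 ^ k *\<^sub>R h)) \<partial>lborel)"
    proof (intro mult_left_mono nn_integral_mono)
      fix h :: 'a
      show "shift_jump E r (2 ^ k *\<^sub>R h) * indicator ?B (2 ^ k *\<^sub>R h)
          \<le> ennreal (2 ^ k) * (?W h * indicator ?B (2 ^ k *\<^sub>R h))"
      proof (cases "2 ^ k *\<^sub>R h \<in> ?B")
        case True
        then have "shift_jump E (r + 2 ^ k * norm h) h \<le> ?W h"
          by (intro shift_jump_mono E) simp
        then have "2 ^ k * shift_jump E (r + 2 ^ k * norm h) h \<le> 2 ^ k * ?W h"
          by (intro mult_left_mono) auto
        with shift_jump_power2[OF E, of r k h] True show ?thesis
          by (simp flip: ennreal_power)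
      qed simp
    qed simp
    also have "\<dots> = ennreal ((2 ^ k) ^ DIM('a)) * (ennreal (2 ^ k) *
        (\<integral>\<^sup>+h. ?W h * indicator ?B (2 ^ k *\<^sub>R h) \<partial>lborel))"
      by (subst nn_integral_cmult) (measurable, auto)
    finally have "ennreal (d ^ k) * ?L \<le> ennreal (d ^ k) * (ennreal ((2 ^ k) ^ DIM('a)) * (ennreal (2 ^ k) *
        (\<integral>\<^sup>+h. ?W h * indicator ?B (2 ^ k *\<^sub>R h) \<partial>lborel)))"
      by (intro mult_left_mono) auto
    also have "\<dots> = ennreal (d ^ k * ((2 ^ k) ^ DIM('a) * 2 ^ k)) *
        (\<integral>\<^sup>+h. ?W h * indicator ?B (2 ^ k *\<^sub>R h) \<partial>lborel)"
      using d by (simp add: ennreal_mult mult.assoc)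
    also have "d ^ k * ((2 ^ k) ^ DIM('a) * 2 ^ k) = q ^ k"
    proof -
      have "d * (2 ^ DIM('a) * 2) = q"
        by (simp add: d_def q_def \<beta>_def powr_diff powr_add powr_realpow)
      moreover have "d ^ k * ((2 ^ k) ^ DIM('a) * 2 ^ k) = (d * (2 ^ DIM('a) * 2)) ^ k"
        by (simp only: power_mult_distrib power_mult[symmetric] mult.commute[of k])
      ultimately show ?thesis by simp
    qed
    also have "ennreal (q ^ k) * (\<integral>\<^sup>+h. ?W h * indicator ?B (2 ^ k *\<^sub>R h) \<partial>lborel)
        = (\<integral>\<^sup>+h. ennreal (q ^ k) * (?W h * indicator ?B (2 ^ k *\<^sub>R h)) \<partial>lborel)"
      by (subst nn_integral_cmult) (measurable, auto)
    also have "\<dots> = (\<integral>\<^sup>+h. ennreal (if 2 ^ k < \<rho> / norm h then q ^ k else 0) * ?W h \<partial>lborel)"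
    proof (intro nn_integral_cong)
      fix h :: 'a
      show "ennreal (q ^ k) * (?W h * indicator ?B (2 ^ k *\<^sub>R h))
          = ennreal (if 2 ^ k < \<rho> / norm h then q ^ k else 0) * ?W h"
        by (cases "h = 0") (auto simp: indicator_def pos_less_divide_eq shift_jump_def)
    qed
    finally show ?thesis .
  qed
  \<comment> \<open>At \<open>h = 0\<close> the kernel has the value \<open>0\<close>; this is harmless as the zero shift moves nothing.\<close>
  have pw: "(\<Sum>k. ennreal (if 2 ^ k < \<rho> / norm h then q ^ k else 0) * ?W h)
      \<le> ennreal (2 * \<rho> powr \<beta>) * (?W h * ennreal (1 / norm h powr \<beta>) * indicator (ball 0 \<rho>) h)" for h
  proof (cases "h = 0 \<or> norm h \<ge> \<rho>")
    case True
    have z: "ennreal (if 2 ^ k < \<rho> / norm h then q ^ k else 0) * ?W h = 0" for k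
    proof (cases "h = 0")
      case False
      with True have "\<rho> / norm h \<le> 1" by (simp add: field_simps)
      also have "1 \<le> (2::real) ^ k" by simp
      finally show ?thesis by simp
    qed (simp add: shift_jump_def)
    have "(\<Sum>k. ennreal (if 2 ^ k < \<rho> / norm h then q ^ k else 0) * ?W h) = (\<Sum>k::nat. 0)"
      by (rule suminf_cong) (rule z)
    then show ?thesis by (simp del: ennreal_suminf_multc)
  next
    case False
    then have h: "0 < norm h" "norm h < \<rho>" by auto
    have "(\<Sum>k. ennreal (if 2 ^ k < \<rho> / norm h then q ^ k else 0)) \<le> ennreal (2 * (\<rho> / norm h) powr \<beta>)"
    proof (rule suminf_le_const)
      fix K
      have "(\<Sum>k<K. ennreal (if 2 ^ k < \<rho> / norm h then q ^ k else 0))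
        = ennreal (\<Sum>k<K. if 2 ^ k < \<rho> / norm h then q ^ k else 0)"
        by (intro sum_ennreal) (auto simp: q_def)
      also have "\<dots> \<le> ennreal (2 * (\<rho> / norm h) powr \<beta>)"
        unfolding q_def by (intro ennreal_leI sum_dyadic_powr_le \<beta>) (use h \<rho> in auto)
      finally show "(\<Sum>k<K. ennreal (if 2 ^ k < \<rho> / norm h then q ^ k else 0))
        \<le> ennreal (2 * (\<rho> / norm h) powr \<beta>)" .
    qed simp
    also have "\<dots> = ennreal (2 * \<rho> powr \<beta>) * ennreal (1 / norm h powr \<beta>)"
      using h \<rho> by (simp add: powr_divide ennreal_mult[symmetric])
    finally have "(\<Sum>k. ennreal (if 2 ^ k < \<rho> / norm h then q ^ k else 0)) * ?W h
      \<le> (ennreal (2 * \<rho> powr \<beta>) * ennreal (1 / norm h powr \<beta>)) * ?W h"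
      by (intro mult_right_mono) auto
    with h show ?thesis by (simp add: mult_ac)
  qed
  have "(\<Sum>k. ennreal (d ^ k)) = ennreal (1 / (1 - d))"
    using d by (subst suminf_ennreal2) (auto simp: suminf_geometric summable_geometric)
  then have "ennreal (1 / (1 - d)) * ?L = (\<Sum>k. ennreal (d ^ k) * ?L)"
    by simp
  also have "\<dots> \<le> (\<Sum>k. \<integral>\<^sup>+h. ennreal (if 2 ^ k < \<rho> / norm h then q ^ k else 0) * ?W h \<partial>lborel)"
    by (intro suminf_le step) auto
  also have "\<dots> = (\<integral>\<^sup>+h. (\<Sum>k. ennreal (if 2 ^ k < \<rho> / norm h then q ^ k else 0) * ?W h) \<partial>lborel)"
    by (intro nn_integral_suminf[symmetric]) auto
  also have "\<dots> \<le> (\<integral>\<^sup>+h. ennreal (2 * \<rho> powr \<beta>) *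
      (?W h * ennreal (1 / norm h powr \<beta>) * indicator (ball 0 \<rho>) h) \<partial>lborel)"
    by (intro nn_integral_mono pw)
  also have "\<dots> = ennreal (2 * \<rho> powr \<beta>) * ?R"
    by (subst nn_integral_cmult) (measurable, auto)
  finally have main: "ennreal (1 / (1 - d)) * ?L \<le> ennreal (2 * \<rho> powr \<beta>) * ?R" .
  have "?L = ennreal (1 - \<alpha>) * (ennreal (1 / (1 - \<alpha>)) * ?L)"
    using \<alpha> by (simp add: mult.assoc[symmetric] ennreal_mult[symmetric])
  also have "\<dots> \<le> ennreal (1 - \<alpha>) * (ennreal (1 / (1 - d)) * ?L)"
    using one_minus_le_geometric_2_powr[OF \<alpha>(2)]
    by (intro mult_left_mono mult_right_mono ennreal_leI) (auto simp: d_def)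
  also have "\<dots> \<le> ennreal (1 - \<alpha>) * (ennreal (2 * \<rho> powr \<beta>) * ?R)"
    by (intro mult_left_mono main) simp
  also have "\<dots> = ennreal ?c * ?R"
  proof -
    have "ennreal (1 - \<alpha>) * ennreal (2 * \<rho> powr \<beta>) = ennreal ?c"
      using \<alpha> by (simp add: ennreal_mult[symmetric] mult.assoc mult.left_commute)
    then show ?thesis by (simp only: mult.assoc[symmetric])
  qed
  finally show ?thesis .
qed


section \<open>The relative fractional isoperimetric inequality\<close>

text \<open>
  The radius \<open>\<rho>\<close> is chosen so that a ball of radius \<open>\<rho> / 2\<close> has twice the measure \<open>m\<close> of the part of
  \<open>E\<close> in the ball. Every point \<open>y\<close> of that part has such a ball within distance \<open>\<rho>\<close> and inside
  \<open>ball 0 r\<close>: pull the center from \<open>y\<close> towards the origin. At least half of it lies off \<open>E\<close>, so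
  at least a measure \<open>m\<close> of shifts moves \<open>y\<close> out of \<open>E\<close>.
\<close>
lemma shift_jump_average_ge:
  fixes E :: "'a::euclidean_space set"
  assumes E [measurable]: "E \<in> sets borel" and \<rho>: "0 < \<rho>" "\<rho> \<le> 2 * r"
    and m: "2 * measure lborel (E \<inter> ball 0 r) = measure lborel (ball (0::'a) (\<rho> / 2))"
  shows "ennreal ((measure lborel (E \<inter> ball 0 r))\<^sup>2) \<le> (\<integral>\<^sup>+h\<in>ball 0 \<rho>. shift_jump E r h \<partial>lborel)"
proof -
  define F where "F = E \<inter> ball 0 r"
  define m where "m = measure lborel F"
  have F [measurable]: "F \<in> sets borel" by (simp add: F_def)
  have Ffin: "emeasure lborel F = ennreal m"
  proof -
    have "bounded F" unfolding F_def using bounded_ball by (rule bounded_subset) auto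
    then have "emeasure lborel F < \<infinity>" by (rule emeasure_bounded_finite)
    then show ?thesis unfolding m_def by (intro emeasure_eq_ennreal_measure) auto
  qed
  let ?J = "\<lambda>h y. if norm y < r \<and> (y \<in> E) \<noteq> (y + h \<in> E) then 1 else (0::ennreal)"
  have far: "ennreal m \<le> (\<integral>\<^sup>+h. indicator (ball 0 \<rho>) h * ?J h y \<partial>lborel)" if y: "y \<in> F" for y
  proof -
    \<comment> \<open>The ball of radius \<open>\<rho> / 2\<close> about \<open>c\<close> is contained in both \<open>ball 0 r\<close> and \<open>ball y \<rho>\<close>.\<close>
    define c where "c = (1 - \<rho> / (2 * r)) *\<^sub>R y"
    have r: "0 < r" using \<rho> by simp
    have ny: "norm y < r" using y by (simp add: F_def)
    have cy: "norm (c - y) \<le> \<rho> / 2"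
    proof -
      have "c - y = - (\<rho> / (2 * r)) *\<^sub>R y" by (simp add: c_def algebra_simps)
      then have "norm (c - y) = \<rho> / (2 * r) * norm y" using r \<rho> by simp
      also have "\<dots> \<le> \<rho> / (2 * r) * r" using r \<rho> ny by (intro mult_left_mono) auto
      finally show ?thesis using r by simp
    qed
    have c0: "norm c \<le> r - \<rho> / 2"
    proof -
      have "0 \<le> 1 - \<rho> / (2 * r)" using r \<rho> by (simp add: field_simps)
      then have "norm c = (1 - \<rho> / (2 * r)) * norm y" by (simp add: c_def)
      also have "\<dots> \<le> (1 - \<rho> / (2 * r)) * r"
        using \<open>0 \<le> 1 - \<rho> / (2 * r)\<close> ny by (intro mult_left_mono) auto
      finally show ?thesis using r by (simp add: algebra_simps)
    qed
    have "ennreal (2 * m) = emeasure lborel (ball c (\<rho> / 2))"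
      using m \<rho> by (simp add: m_def F_def emeasure_ball content_ball)
    also have "\<dots> \<le> emeasure lborel (ball c (\<rho> / 2) - F \<union> F)"
      by (intro emeasure_mono) auto
    also have "\<dots> \<le> emeasure lborel (ball c (\<rho> / 2) - F) + ennreal m"
      unfolding Ffin[symmetric] by (intro emeasure_subadditive) auto
    finally have "ennreal m \<le> emeasure lborel (ball c (\<rho> / 2) - F)"
      by (cases "emeasure lborel (ball c (\<rho> / 2) - F)")
         (auto simp: m_def ennreal_plus[symmetric] simp del: ennreal_plus)
    also have "\<dots> = (\<integral>\<^sup>+z. indicator (ball c (\<rho> / 2) - F) z \<partial>lborel)"
      by simp
    also have "\<dots> = (\<integral>\<^sup>+h. indicator (ball c (\<rho> / 2) - F) (y + h) \<partial>lborel)"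
      using F by (intro nn_integral_lborel_translate[symmetric] borel_measurable_indicator sets.Diff) auto
    also have "\<dots> \<le> (\<integral>\<^sup>+h. indicator (ball 0 \<rho>) h * ?J h y \<partial>lborel)"
    proof (intro nn_integral_mono)
      fix h
      show "indicator (ball c (\<rho> / 2) - F) (y + h) \<le> indicator (ball 0 \<rho>) h * ?J h y"
      proof (cases "y + h \<in> ball c (\<rho> / 2) - F")
        case True
        then have "norm (c - (y + h)) < \<rho> / 2" by (simp add: dist_norm)
        moreover have "norm h \<le> norm (c - y) + norm (c - (y + h))"
          using norm_triangle_ineq4[of "c - y" "c - (y + h)"] by simp
        moreover have "norm (y + h) \<le> norm c + norm (c - (y + h))"
          using norm_triangle_ineq4[of c "c - (y + h)"] by (simp add: add.commute)
        ultimately have "norm h < \<rho>" "norm (y + h) < r" using cy c0 by linarith+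
        with True y ny show ?thesis by (auto simp: F_def)
      qed simp
    qed
    finally show ?thesis .
  qed
  have "ennreal (m\<^sup>2) = ennreal m * emeasure lborel F"
    by (simp add: Ffin m_def power2_eq_square ennreal_mult)
  also have "\<dots> = (\<integral>\<^sup>+y. ennreal m * indicator F y \<partial>lborel)"
    by (simp add: nn_integral_cmult_indicator)
  also have "\<dots> \<le> (\<integral>\<^sup>+y. (\<integral>\<^sup>+h. indicator (ball 0 \<rho>) h * ?J h y \<partial>lborel) \<partial>lborel)"
  proof (intro nn_integral_mono)
    fix y
    show "ennreal m * indicator F y \<le> (\<integral>\<^sup>+h. indicator (ball 0 \<rho>) h * ?J h y \<partial>lborel)"
      using far[of y] by (cases "y \<in> F") simp_all
  qed
  also have "\<dots> = (\<integral>\<^sup>+h. (\<integral>\<^sup>+y. indicator (ball 0 \<rho>) h * ?J h y \<partial>lborel) \<partial>lborel)"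
    by (rule lborel_pair.Fubini'[symmetric], rule measurable_lborel_pair)
      (simp add: indicator_def, measurable)
  also have "\<dots> = (\<integral>\<^sup>+h. indicator (ball 0 \<rho>) h * (\<integral>\<^sup>+y. ?J h y \<partial>lborel) \<partial>lborel)"
    by (intro nn_integral_cong nn_integral_cmult) measurable
  finally show ?thesis
    by (simp add: shift_jump_nn_integral m_def F_def mult.commute)
qed

text \<open>
  Tonelli's theorem, after the substitution of \<open>y + h\<close> for the second variable of the double integral.
\<close>
lemma nn_integral_shift_jump_kernel:
  fixes E :: "'a::euclidean_space set"
  assumes E [measurable]: "E \<in> sets borel"
  shows "(\<integral>\<^sup>+h. shift_jump E r h * ennreal (1 / norm h powr (real DIM('a) + \<alpha>)) \<partial>lborel)
    = (\<integral>\<^sup>+y\<in>ball 0 r. frac_diff \<alpha> (indicat_real E) y \<partial>lborel)"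
proof -
  let ?J = "\<lambda>h y. if norm y < r \<and> (y \<in> E) \<noteq> (y + h \<in> E) then 1 else (0::ennreal)"
  let ?k = "\<lambda>h::'a. ennreal (1 / norm h powr (real DIM('a) + \<alpha>))"
  have "(\<integral>\<^sup>+h. shift_jump E r h * ?k h \<partial>lborel) = (\<integral>\<^sup>+h. (\<integral>\<^sup>+y. ?J h y * ?k h \<partial>lborel) \<partial>lborel)"
    unfolding shift_jump_nn_integral[OF E]
    by (intro nn_integral_cong nn_integral_multc[symmetric]) measurable
  also have "\<dots> = (\<integral>\<^sup>+y. (\<integral>\<^sup>+h. ?J h y * ?k h \<partial>lborel) \<partial>lborel)"
    by (rule lborel_pair.Fubini', rule measurable_lborel_pair) measurable
  also have "\<dots> = (\<integral>\<^sup>+y\<in>ball 0 r. frac_diff \<alpha> (indicat_real E) y \<partial>lborel)"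
  proof (intro nn_integral_cong)
    fix y :: 'a
    let ?g = "\<lambda>z. ennreal (\<bar>indicat_real E y - indicat_real E z\<bar> / norm (y - z) powr (real DIM('a) + \<alpha>))"
    have "(\<integral>\<^sup>+h. ?J h y * ?k h \<partial>lborel) = (\<integral>\<^sup>+h. ?g (y + h) * indicator (ball 0 r) y \<partial>lborel)"
      by (intro nn_integral_cong) (auto simp: indicator_def)
    also have "\<dots> = (\<integral>\<^sup>+z. ?g z * indicator (ball 0 r) y \<partial>lborel)"
      by (rule nn_integral_lborel_translate) measurable
    also have "\<dots> = (\<integral>\<^sup>+z. ?g z \<partial>lborel) * indicator (ball 0 r) y"
      by (rule nn_integral_multc) measurable
    finally show "(\<integral>\<^sup>+h. ?J h y * ?k h \<partial>lborel) = frac_diff \<alpha> (indicat_real E) y * indicator (ball 0 r) y"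
      by (simp add: frac_diff_def nn_integral_completion)
  qed
  finally show ?thesis .
qed

text \<open>
  The base of the square is at least \<open>1\<close>, so that the square bounds its powers with exponent
  \<open>1 + \<alpha> / n\<close> uniformly in \<open>\<alpha> < 1\<close>.
\<close>
definition isoperimetric_const :: "'a::euclidean_space itself \<Rightarrow> real" where
  "isoperimetric_const _ = 2 * (max 1 (2 ^ (DIM('a) + 1) / unit_ball_vol (real DIM('a))))\<^sup>2"

lemma isoperimetric_const_pos: "0 < isoperimetric_const T"
  unfolding isoperimetric_const_def
  by (intro mult_pos_pos zero_less_power) (auto simp: less_max_iff_disj)

text \<open>
  Combine \<open>shift_jump_average_ge\<close> and \<open>shift_jump_average_le\<close> for \<open>\<rho> = 2 * \<sigma>\<close>, where a ball of radius \<open>\<sigma>\<close> has volume \<open>2 * m\<close>.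
  The lower bound is \<open>m\<^sup>2\<close> and the upper bound has the factor \<open>\<rho> powr (n + \<alpha>)\<close>, which is of the order
  of \<open>m powr (1 + \<alpha> / n)\<close>; dividing leaves \<open>m powr (1 - \<alpha> / n)\<close>. The assumption that \<open>E\<close> fills at most
  half of the ball ensures \<open>\<sigma> \<le> r\<close>.
\<close>
proposition relative_fractional_isoperimetric_half:
  fixes E :: "'a::euclidean_space set"
  assumes E [measurable]: "E \<in> sets borel" and \<alpha>: "0 < \<alpha>" "\<alpha> < 1" and r: "0 < r"
    and half: "2 * measure lborel (E \<inter> ball 0 r) \<le> measure lborel (ball (0::'a) r)"
  shows "ennreal (measure lborel (E \<inter> ball 0 r) powr (1 - \<alpha> / real DIM('a)))
    \<le> ennreal (isoperimetric_const TYPE('a) * (1 - \<alpha>)) *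
      (\<integral>\<^sup>+y\<in>ball 0 (3 * r). frac_diff \<alpha> (indicat_real E) y \<partial>lborel)"
proof -
  define m where "m = measure lborel (E \<inter> ball 0 r)"
  define n where "n = real DIM('a)"
  define \<omega> where "\<omega> = unit_ball_vol n"
  define \<kappa> where "\<kappa> = max 1 (2 ^ (DIM('a) + 1) / \<omega>)"
  let ?P = "\<integral>\<^sup>+y\<in>ball 0 (3 * r). frac_diff \<alpha> (indicat_real E) y \<partial>lborel"
  have n: "1 \<le> n" using DIM_positive[where 'a='a] by (simp add: n_def Suc_le_eq)
  have \<omega>: "0 < \<omega>" using n by (simp add: \<omega>_def)
  show ?thesis
  proof (cases "m = 0")
    case True
    then show ?thesis by (simp add: m_def)
  next
    case False
    then have m: "0 < m" by (simp add: m_def zero_less_measure_iff)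
    define \<sigma> where "\<sigma> = (2 * m / \<omega>) powr (1 / n)"
    have \<sigma>: "0 < \<sigma>" using m \<omega> by (simp add: \<sigma>_def)
    have \<sigma>n: "\<sigma> powr n = 2 * m / \<omega>" using m n \<omega> by (simp add: \<sigma>_def powr_powr)
    then have \<sigma>n': "\<sigma> ^ DIM('a) = 2 * m / \<omega>" using \<sigma> by (simp add: n_def powr_realpow)
    have vol: "measure lborel (ball (0::'a) s) = \<omega> * s ^ DIM('a)" if "0 \<le> s" for s
      using that by (simp add: content_ball \<omega>_def n_def)
    have "\<sigma> ^ DIM('a) \<le> r ^ DIM('a)"
      using half vol[of r] r \<omega> by (simp add: \<sigma>n' m_def field_simps)
    then have \<sigma>r: "\<sigma> \<le> r"
      using power_less_imp_less_base[of r "DIM('a)" \<sigma>] power_strict_mono[of r \<sigma> "DIM('a)"] r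
      by (meson DIM_positive le_less_linear less_le_not_le)
    have "ennreal (m\<^sup>2) \<le> (\<integral>\<^sup>+h\<in>ball 0 (2 * \<sigma>). shift_jump E r h \<partial>lborel)"
      unfolding m_def using \<sigma> \<sigma>r \<omega> vol[of \<sigma>]
      by (intro shift_jump_average_ge E) (auto simp: \<sigma>n' m_def)
    also have "\<dots> \<le> ennreal (2 * (1 - \<alpha>) * (2 * \<sigma>) powr (n + \<alpha>)) *
       (\<integral>\<^sup>+h\<in>ball 0 (2 * \<sigma>). shift_jump E (r + 2 * \<sigma>) h * ennreal (1 / norm h powr (n + \<alpha>)) \<partial>lborel)"
      unfolding n_def by (intro shift_jump_average_le E \<alpha>) (use \<sigma> in auto)
    also have "\<dots> \<le> ennreal (2 * (1 - \<alpha>) * (2 * \<sigma>) powr (n + \<alpha>)) *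
       (\<integral>\<^sup>+h. shift_jump E (3 * r) h * ennreal (1 / norm h powr (n + \<alpha>)) \<partial>lborel)"
      using \<sigma>r by (intro mult_left_mono nn_integral_mono)
        (auto simp: indicator_def intro!: mult_right_mono shift_jump_mono)
    also have "\<dots> = ennreal (2 * (1 - \<alpha>) * (2 * \<sigma>) powr (n + \<alpha>)) * ?P"
      unfolding n_def by (simp only: nn_integral_shift_jump_kernel[OF E])
    finally have sq: "ennreal (m\<^sup>2) \<le> ennreal (2 * (1 - \<alpha>) * (2 * \<sigma>) powr (n + \<alpha>)) * ?P" .
    have \<rho>: "(2 * \<sigma>) powr (n + \<alpha>) \<le> \<kappa>\<^sup>2 * m powr (1 + \<alpha> / n)"
    proof -
      have "(2 * \<sigma>) powr n = 2 ^ (DIM('a) + 1) / \<omega> * m"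
        using \<sigma> by (simp add: powr_mult \<sigma>n) (simp add: n_def powr_realpow)
      moreover have "n + \<alpha> = n * (1 + \<alpha> / n)" using n by (simp add: field_simps)
      ultimately have "(2 * \<sigma>) powr (n + \<alpha>) = (2 ^ (DIM('a) + 1) / \<omega>) powr (1 + \<alpha> / n) * m powr (1 + \<alpha> / n)"
        using m \<omega> by (simp only: powr_powr[symmetric]) (simp add: powr_mult[symmetric])
      also have "(2 ^ (DIM('a) + 1) / \<omega>) powr (1 + \<alpha> / n) \<le> \<kappa> powr (1 + \<alpha> / n)"
        using \<omega> n \<alpha> by (intro powr_mono2) (auto simp: \<kappa>_def)
      also have "\<kappa> powr (1 + \<alpha> / n) \<le> \<kappa> powr 2"
        using n \<alpha> by (intro powr_mono) (auto simp: \<kappa>_def field_simps)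
      also have "\<kappa> powr 2 = \<kappa>\<^sup>2" by (simp add: \<kappa>_def powr_numeral)
      finally show ?thesis by (simp add: mult_right_mono)
    qed
    have "m powr (1 - \<alpha> / n) = m powr (- (1 + \<alpha> / n)) * m\<^sup>2"
      using m by (simp add: powr_add[symmetric] powr_numeral[symmetric] del: powr_numeral)
    then have "ennreal (m powr (1 - \<alpha> / n)) = ennreal (m powr (- (1 + \<alpha> / n))) * ennreal (m\<^sup>2)"
      by (simp add: ennreal_mult)
    also have "\<dots> \<le> ennreal (m powr (- (1 + \<alpha> / n))) * (ennreal (2 * (1 - \<alpha>) * (2 * \<sigma>) powr (n + \<alpha>)) * ?P)"
      by (intro mult_left_mono sq) simp
    also have "\<dots> \<le> ennreal (m powr (- (1 + \<alpha> / n))) *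
        (ennreal (2 * (1 - \<alpha>) * (\<kappa>\<^sup>2 * m powr (1 + \<alpha> / n))) * ?P)"
      using \<alpha> by (intro mult_left_mono mult_right_mono ennreal_leI \<rho>) auto
    also have "\<dots> = ennreal (m powr (- (1 + \<alpha> / n)) * (2 * (1 - \<alpha>) * (\<kappa>\<^sup>2 * m powr (1 + \<alpha> / n)))) * ?P"
      using \<alpha> by (simp add: ennreal_mult mult.assoc)
    also have "m powr (- (1 + \<alpha> / n)) * (2 * (1 - \<alpha>) * (\<kappa>\<^sup>2 * m powr (1 + \<alpha> / n)))
        = isoperimetric_const TYPE('a) * (1 - \<alpha>)"
      using m by (simp add: isoperimetric_const_def \<kappa>_def \<omega>_def n_def powr_minus field_simps)
    finally show ?thesis by (simp add: m_def n_def)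
  qed
qed

lemma frac_diff_indicat_compl: "frac_diff \<alpha> (indicat_real (- E)) y = frac_diff \<alpha> (indicat_real E) y"
  unfolding frac_diff_def by (intro nn_integral_cong) (auto simp: indicator_def)

text \<open>
  One of \<open>E\<close> and its complement fills at most half of the ball, and both have the same \<open>frac_diff\<close>.
\<close>
theorem relative_fractional_isoperimetric:
  fixes E :: "'a::euclidean_space set"
  assumes E [measurable]: "E \<in> sets borel" and \<alpha>: "0 < \<alpha>" "\<alpha> < 1" and r: "0 < r"
  defines "m \<equiv> min (measure lborel (E \<inter> ball 0 r)) (measure lborel (ball 0 r - E))"
  shows "ennreal (m powr (1 - \<alpha> / real DIM('a)))
    \<le> ennreal (isoperimetric_const TYPE('a) * (1 - \<alpha>)) *
      (\<integral>\<^sup>+y\<in>ball 0 (3 * r). frac_diff \<alpha> (indicat_real E) y \<partial>lborel)"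
proof -
  have fin: "emeasure lborel A \<noteq> \<infinity>" if "A \<subseteq> ball (0::'a) r" for A
    using emeasure_bounded_finite[OF bounded_subset[OF bounded_ball that]] by simp
  have "measure lborel ((E \<inter> ball 0 r) \<union> (ball 0 r - E))
      = measure lborel (E \<inter> ball 0 r) + measure lborel (ball 0 r - E)"
    by (intro measure_Union fin) auto
  also have "(E \<inter> ball 0 r) \<union> (ball 0 r - E) = ball 0 r" by auto
  finally have sum: "measure lborel (ball (0::'a) r)
      = measure lborel (E \<inter> ball 0 r) + measure lborel (ball 0 r - E)" .
  show ?thesis
  proof (cases "measure lborel (E \<inter> ball 0 r) \<le> measure lborel (ball 0 r - E)")
    case True
    then show ?thesis
      using relative_fractional_isoperimetric_half[OF E \<alpha> r] sum by (simp add: m_def)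
  next
    case False
    have "- E \<inter> ball 0 r = ball 0 r - E" by auto
    moreover have "- E \<in> sets borel" by measurable
    ultimately show ?thesis
      using relative_fractional_isoperimetric_half[of "- E", OF _ \<alpha> r] sum False
      by (simp add: m_def frac_diff_indicat_compl)
  qed
qed

section \<open>Layer-cake decompositions of oscillating integrals\<close>

text \<open>
  If \<open>\<phi>\<close> is a superposition of layers \<open>K y s\<close>, Fubini's theorem passes the decomposition to the
  integral of \<open>h * \<phi>\<close> while the cancellation inside each layer is kept. The layers need only
  add up to \<open>\<phi>\<close> where \<open>h\<close> does not vanish.
\<close>
lemma abs_integral_layer_le:
  fixes h :: "'a \<Rightarrow> real" and K :: "'a \<Rightarrow> 'b \<Rightarrow> real"
  assumes "sigma_finite_measure M" "sigma_finite_measure N"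
    and h [measurable]: "h \<in> borel_measurable M"
    and K [measurable]: "case_prod K \<in> borel_measurable (M \<Otimes>\<^sub>M N)"
    and K0: "\<And>y s. 0 \<le> K y s" and \<phi>0: "\<And>y. 0 \<le> \<phi> y"
    and layers: "\<And>y. h y \<noteq> 0 \<Longrightarrow> (\<integral>\<^sup>+s. ennreal (K y s) \<partial>N) = ennreal (\<phi> y)"
    and int: "integrable M (\<lambda>y. h y * \<phi> y)"
  shows "ennreal \<bar>\<integral>y. h y * \<phi> y \<partial>M\<bar> \<le> (\<integral>\<^sup>+s. ennreal \<bar>\<integral>y. h y * K y s \<partial>M\<bar> \<partial>N)"
proof -
  interpret M: sigma_finite_measure M by fact
  interpret N: sigma_finite_measure N by fact
  interpret P: pair_sigma_finite M N ..
  have inner: "(\<integral>s. h y * K y s \<partial>N) = h y * \<phi> y" if y: "y \<in> space M" for y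
  proof (cases "h y = 0")
    case False
    have [measurable]: "K y \<in> borel_measurable N"
      using measurable_compose[OF measurable_Pair1'[OF y] K] by simp
    have "(\<integral>s. K y s \<partial>N) = enn2real (\<integral>\<^sup>+s. ennreal (K y s) \<partial>N)"
      by (intro integral_eq_nn_integral) (auto simp: K0)
    then show ?thesis using layers[OF False] \<phi>0 by simp
  qed simp
  have intP: "integrable (M \<Otimes>\<^sub>M N) (case_prod (\<lambda>y s. h y * K y s))"
  proof (rule integrableI_bounded)
    have "(\<integral>\<^sup>+z. ennreal (norm (case_prod (\<lambda>y s. h y * K y s) z)) \<partial>(M \<Otimes>\<^sub>M N))
        = (\<integral>\<^sup>+y. (\<integral>\<^sup>+s. ennreal (norm (h y * K y s)) \<partial>N) \<partial>M)"
      by (subst N.nn_integral_fst[symmetric]) auto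
    also have "\<dots> = (\<integral>\<^sup>+y. ennreal (norm (h y * \<phi> y)) \<partial>M)"
    proof (intro nn_integral_cong)
      fix y assume y: "y \<in> space M"
      have [measurable]: "K y \<in> borel_measurable N"
        using measurable_compose[OF measurable_Pair1'[OF y] K] by simp
      have "(\<integral>\<^sup>+s. ennreal (norm (h y * K y s)) \<partial>N) = (\<integral>\<^sup>+s. ennreal \<bar>h y\<bar> * ennreal (K y s) \<partial>N)"
        by (intro nn_integral_cong) (simp add: abs_mult K0 ennreal_mult)
      also have "\<dots> = ennreal \<bar>h y\<bar> * (\<integral>\<^sup>+s. ennreal (K y s) \<partial>N)"
        by (intro nn_integral_cmult) measurable
      also have "\<dots> = ennreal (norm (h y * \<phi> y))"
        by (cases "h y = 0") (simp_all add: layers abs_mult \<phi>0 ennreal_mult)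
      finally show "(\<integral>\<^sup>+s. ennreal (norm (h y * K y s)) \<partial>N) = ennreal (norm (h y * \<phi> y))" .
    qed
    also have "\<dots> < \<infinity>" using int by (simp add: integrable_iff_bounded)
    finally show "(\<integral>\<^sup>+z. ennreal (norm (case_prod (\<lambda>y s. h y * K y s) z)) \<partial>(M \<Otimes>\<^sub>M N)) < \<infinity>" .
  qed measurable
  have "(\<integral>y. h y * \<phi> y \<partial>M) = (\<integral>y. (\<integral>s. h y * K y s \<partial>N) \<partial>M)"
    by (intro Bochner_Integration.integral_cong refl) (rule inner[symmetric])
  also have "\<dots> = (\<integral>s. (\<integral>y. h y * K y s \<partial>M) \<partial>N)"
    by (rule P.Fubini_integral[symmetric]) (rule intP)
  finally show ?thesis
    using integral_norm_bound_ennreal[OF P.integrable_snd[OF intP]] by simp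
qed

lemma nn_integral_powr_tail:
  fixes a \<beta> :: real
  assumes "0 < a" "0 < \<beta>"
  shows "(\<integral>\<^sup>+s\<in>{a<..}. ennreal (s powr (- \<beta> - 1)) \<partial>lborel) = ennreal (a powr - \<beta> / \<beta>)"
proof -
  have "(\<integral>\<^sup>+s\<in>{a<..}. ennreal (s powr (- \<beta> - 1)) \<partial>lborel)
      = (\<integral>\<^sup>+s\<in>{a..}. ennreal (s powr (- \<beta> - 1)) \<partial>lborel)"
    by (intro nn_integral_cong_AE eventually_mono[OF AE_lborel_singleton[of a]])
      (auto simp: indicator_def)
  also have "\<dots> = ennreal (0 - (- (a powr - \<beta> / \<beta>)))"
  proof (rule nn_integral_FTC_atLeast)
    fix x assume "a \<le> x"
    with assms show "((\<lambda>s. - (s powr - \<beta> / \<beta>)) has_real_derivative x powr (- \<beta> - 1)) (at x)"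
      by (auto intro!: derivative_eq_intros simp: field_simps)
  next
    have "((\<lambda>s. - (s powr - \<beta> / \<beta>)) \<longlongrightarrow> - (0 / \<beta>)) at_top"
      using assms by (intro tendsto_intros tendsto_neg_powr filterlim_ident) auto
    then show "((\<lambda>s. - (s powr - \<beta> / \<beta>)) \<longlongrightarrow> 0) at_top" by simp
  qed auto
  finally show ?thesis by simp
qed

section \<open>Rough homogeneous kernels\<close>

text \<open>
  A Borel kernel, with the conditions on the sphere expressed through cones over subsets of the sphere,
  that is, in terms of the unit ball. The case \<open>N = 0\<close> is included; it forces \<open>\<Omega>\<close> to vanish
  almost everywhere.
\<close>
locale rough_kernel =
  fixes \<Omega> :: "'a::euclidean_space \<Rightarrow> real" and \<alpha> N :: real
  assumes dim: "2 \<le> DIM('a)"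
    and alpha: "0 < \<alpha>" "\<alpha> < 1"
    and N_nonneg: "0 \<le> N"
    and measurable_kernel [measurable]: "\<Omega> \<in> borel_measurable borel"
    and homogeneous: "homogeneous_deg0 \<Omega>"
    and weak: "\<And>u. 0 < u \<Longrightarrow> emeasure lborel {y \<in> ball 0 1. \<bar>\<Omega> y\<bar> > u}
          \<le> ennreal ((N / u) powr (real DIM('a) / \<alpha>) / real DIM('a))"
    and mean_zero: "(LINT y:ball 0 1|lborel. \<Omega> y) = 0"
begin

lemma kernel_scaleR: "0 < r \<Longrightarrow> y \<noteq> 0 \<Longrightarrow> \<Omega> (r *\<^sub>R y) = \<Omega> y"
  using homogeneous by (simp add: homogeneous_deg0_def)

lemma emeasure_level_ball_le:
  assumes s: "0 < s" and u: "0 < u"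
  shows "emeasure lborel {y \<in> ball 0 s. \<bar>\<Omega> y\<bar> > u}
    \<le> ennreal (s ^ DIM('a) * (N / u) powr (real DIM('a) / \<alpha>) / real DIM('a))"
proof -
  let ?S = "\<lambda>s. {y \<in> ball 0 s. \<bar>\<Omega> y\<bar> > u}"
  have meas: "?S s \<in> sets borel" for s by measurable
  have AE0: "AE y in lborel. y \<noteq> (0::'a)"
    by (rule AE_lborel_singleton)
  have "emeasure lborel (?S s) = (\<integral>\<^sup>+y. indicator (?S s) y \<partial>lborel)"
    using meas by simp
  also have "\<dots> = ennreal (s ^ DIM('a)) * (\<integral>\<^sup>+y. indicator (?S s) (s *\<^sub>R y) \<partial>lborel)"
    using s meas by (subst nn_integral_lborel_scale[of _ s]) auto
  also have "(\<integral>\<^sup>+y. indicator (?S s) (s *\<^sub>R y) \<partial>lborel) = (\<integral>\<^sup>+y. indicator (?S 1) y \<partial>lborel)"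
    by (intro nn_integral_cong_AE eventually_mono[OF AE0])
      (use s in \<open>auto simp: indicator_def kernel_scaleR\<close>)
  also have "\<dots> = emeasure lborel (?S 1)" using meas by simp
  finally have "emeasure lborel (?S s) = ennreal (s ^ DIM('a)) * emeasure lborel (?S 1)" .
  also have "\<dots> \<le> ennreal (s ^ DIM('a)) * ennreal ((N / u) powr (real DIM('a) / \<alpha>) / real DIM('a))"
    by (intro mult_left_mono weak u) simp
  finally show ?thesis using s by (simp add: ennreal_mult[symmetric])
qed

lemma kernel_exponent: "2 \<le> real DIM('a) / \<alpha>"
proof -
  have "2 * \<alpha> \<le> real DIM('a)" using alpha dim by linarith
  with alpha show ?thesis by (simp add: field_simps)
qed

text \<open>
  Cut \<open>|\<Omega>|\<close> at the height \<open>c\<close>: below it use the measure of \<open>F\<close>, above it integrate the weak bound on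
  the superlevel sets over the heights \<open>u > c\<close>.
\<close>
lemma set_nn_integral_kernel_le_level:
  assumes F [measurable]: "F \<in> sets borel" "F \<subseteq> ball 0 s" and s: "0 < s" and c: "0 < c"
  defines "n \<equiv> real DIM('a)" and "q \<equiv> real DIM('a) / \<alpha>"
  shows "(\<integral>\<^sup>+y\<in>F. ennreal \<bar>\<Omega> y\<bar> \<partial>lborel)
    \<le> ennreal (c * measure lborel F + s ^ DIM('a) * N powr q / n * (c powr - (q - 1) / (q - 1)))"
proof -
  define m where "m = measure lborel F"
  have n: "0 < n" by (simp add: n_def)
  have q: "2 \<le> q" unfolding q_def by (rule kernel_exponent)
  have "emeasure lborel F \<le> emeasure lborel (ball (0::'a) s)"
    using F by (intro emeasure_mono) auto
  also have "\<dots> < \<infinity>" by (intro emeasure_bounded_finite) simp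
  finally have Ffin: "emeasure lborel F = ennreal m"
    unfolding m_def by (intro emeasure_eq_ennreal_measure) auto
  have split: "ennreal \<bar>\<Omega> y\<bar> \<le> ennreal c + (\<integral>\<^sup>+u. indicator {c<..} u * indicator {..<\<bar>\<Omega> y\<bar>} u \<partial>lborel)" for y
  proof -
    have "(\<integral>\<^sup>+u. indicator {c<..} u * indicator {..<\<bar>\<Omega> y\<bar>} u \<partial>lborel)
        = (\<integral>\<^sup>+u. indicator {c<..<\<bar>\<Omega> y\<bar>} u \<partial>lborel)"
      by (intro nn_integral_cong) (auto simp: indicator_def)
    also have "\<dots> = ennreal (max 0 (\<bar>\<Omega> y\<bar> - c))"
      by (cases "c \<le> \<bar>\<Omega> y\<bar>") (auto simp: max_def)
    finally have "ennreal c + (\<integral>\<^sup>+u. indicator {c<..} u * indicator {..<\<bar>\<Omega> y\<bar>} u \<partial>lborel)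
        = ennreal (c + max 0 (\<bar>\<Omega> y\<bar> - c))"
      using c by (simp add: ennreal_plus)
    then show ?thesis by (simp add: ennreal_leI)
  qed
  have "(\<integral>\<^sup>+y\<in>F. ennreal \<bar>\<Omega> y\<bar> \<partial>lborel)
      \<le> (\<integral>\<^sup>+y. ennreal c * indicator F y +
          (\<integral>\<^sup>+u. indicator {c<..} u * indicator {..<\<bar>\<Omega> y\<bar>} u \<partial>lborel) * indicator F y \<partial>lborel)"
    by (intro nn_integral_mono) (auto simp: indicator_def[of F] intro: split)
  also have "\<dots> = ennreal c * emeasure lborel F +
      (\<integral>\<^sup>+y. (\<integral>\<^sup>+u. indicator {c<..} u * (if u < \<bar>\<Omega> y\<bar> then 1 else 0) * indicator F y \<partial>lborel) \<partial>lborel)"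
  proof -
    have "(\<integral>\<^sup>+u. indicator {c<..} u * indicator {..<\<bar>\<Omega> y\<bar>} u \<partial>lborel) * indicator F y
        = (\<integral>\<^sup>+u. indicator {c<..} u * (if u < \<bar>\<Omega> y\<bar> then 1 else 0) * indicator F y \<partial>lborel)" for y
      by (cases "y \<in> F") (auto simp: indicator_def intro!: nn_integral_cong)
    moreover have "(\<integral>\<^sup>+y. ennreal c * indicator F y + (\<integral>\<^sup>+u. indicator {c<..} u *
          (if u < \<bar>\<Omega> y\<bar> then 1 else 0) * indicator F y \<partial>lborel) \<partial>lborel)
        = (\<integral>\<^sup>+y. ennreal c * indicator F y \<partial>lborel) + (\<integral>\<^sup>+y. (\<integral>\<^sup>+u. indicator {c<..} u *
          (if u < \<bar>\<Omega> y\<bar> then 1 else 0) * indicator F y \<partial>lborel) \<partial>lborel)"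
      by (intro nn_integral_add) measurable
    ultimately show ?thesis by (simp add: nn_integral_cmult_indicator)
  qed
  also have "(\<integral>\<^sup>+y. (\<integral>\<^sup>+u. indicator {c<..} u * (if u < \<bar>\<Omega> y\<bar> then 1 else 0) * indicator F y \<partial>lborel) \<partial>lborel)
      = (\<integral>\<^sup>+u. (\<integral>\<^sup>+y. indicator {c<..} u * (if u < \<bar>\<Omega> y\<bar> then 1 else 0) * indicator F y \<partial>lborel) \<partial>lborel)"
    by (rule lborel_pair.Fubini', rule measurable_lborel_pair) measurable
  also have "\<dots> \<le> (\<integral>\<^sup>+u. ennreal (s ^ DIM('a) * N powr q / n) * (ennreal (u powr (- (q - 1) - 1)) * indicator {c<..} u) \<partial>lborel)"
  proof (intro nn_integral_mono)
    fix u :: real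
    show "(\<integral>\<^sup>+y. indicator {c<..} u * (if u < \<bar>\<Omega> y\<bar> then 1 else 0) * indicator F y \<partial>lborel)
        \<le> ennreal (s ^ DIM('a) * N powr q / n) * (ennreal (u powr (- (q - 1) - 1)) * indicator {c<..} u)"
    proof (cases "c < u")
      case True
      with c have u: "0 < u" by simp
      have "(\<integral>\<^sup>+y. indicator {c<..} u * (if u < \<bar>\<Omega> y\<bar> then 1 else 0) * indicator F y \<partial>lborel)
          \<le> (\<integral>\<^sup>+y. indicator {y \<in> ball 0 s. \<bar>\<Omega> y\<bar> > u} y \<partial>lborel)"
        using F by (intro nn_integral_mono) (auto simp: indicator_def)
      also have "\<dots> = emeasure lborel {y \<in> ball 0 s. \<bar>\<Omega> y\<bar> > u}"
        by (rule nn_integral_indicator) measurable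
      also have "\<dots> \<le> ennreal (s ^ DIM('a) * (N / u) powr q / n)"
        unfolding q_def n_def by (rule emeasure_level_ball_le[OF s u])
      also have "s ^ DIM('a) * (N / u) powr q / n = s ^ DIM('a) * N powr q / n * u powr - q"
        using N_nonneg u by (simp add: powr_divide powr_minus field_simps)
      finally show ?thesis using True s n by (simp add: ennreal_mult[symmetric])
    qed simp
  qed
  also have "\<dots> = ennreal (s ^ DIM('a) * N powr q / n) * (\<integral>\<^sup>+u\<in>{c<..}. ennreal (u powr (- (q - 1) - 1)) \<partial>lborel)"
    by (rule nn_integral_cmult) measurable
  also have "\<dots> = ennreal (s ^ DIM('a) * N powr q / n * (c powr - (q - 1) / (q - 1)))"
  proof -
    have "(\<integral>\<^sup>+u\<in>{c<..}. ennreal (u powr (- (q - 1) - 1)) \<partial>lborel) = ennreal (c powr - (q - 1) / (q - 1))"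
      using c q by (intro nn_integral_powr_tail) auto
    moreover have "0 \<le> s ^ DIM('a) * N powr q / n" "0 \<le> c powr - (q - 1) / (q - 1)"
      using s n q by auto
    ultimately show ?thesis by (simp only: ennreal_mult)
  qed
  finally have "(\<integral>\<^sup>+y\<in>F. ennreal \<bar>\<Omega> y\<bar> \<partial>lborel) \<le> ennreal c * emeasure lborel F
      + ennreal (s ^ DIM('a) * N powr q / n * (c powr - (q - 1) / (q - 1)))"
    by (simp add: add_left_mono)
  moreover have "0 \<le> m" by (simp add: m_def)
  ultimately show ?thesis
    using c s q n by (simp add: Ffin m_def[symmetric] ennreal_mult[symmetric] ennreal_plus[symmetric] del: ennreal_plus)
qed

text \<open>
  The height \<open>c\<close> that balances the two terms is the one at which the weak bound equals the measure of
  \<open>F\<close>. The second term is then the first divided by \<open>n * (q - 1)\<close>, where \<open>q = n / \<alpha>\<close>, and since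
  \<open>q \<ge> 2\<close> the constant stays bounded for all \<open>\<alpha>\<close>.
\<close>
lemma set_nn_integral_kernel_le:
  assumes F [measurable]: "F \<in> sets borel" "F \<subseteq> ball 0 s" and s: "0 < s"
  shows "(\<integral>\<^sup>+y\<in>F. ennreal \<bar>\<Omega> y\<bar> \<partial>lborel)
    \<le> ennreal (2 * N * s powr \<alpha> * measure lborel F powr (1 - \<alpha> / real DIM('a)))"
proof -
  define n where "n = real DIM('a)"
  define q where "q = n / \<alpha>"
  define m where "m = measure lborel F"
  have n: "2 \<le> n" using dim by (simp add: n_def)
  have q: "2 \<le> q" unfolding q_def n_def by (rule kernel_exponent)
  have level: "(\<integral>\<^sup>+y\<in>F. ennreal \<bar>\<Omega> y\<bar> \<partial>lborel)
      \<le> ennreal (c * m + s ^ DIM('a) * N powr q / n * (c powr - (q - 1) / (q - 1)))" if "0 < c" for c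
    unfolding m_def q_def n_def using F s that by (rule set_nn_integral_kernel_le_level)
  show ?thesis
  proof (cases "m = 0 \<or> N = 0")
    case True
    have "(\<integral>\<^sup>+y\<in>F. ennreal \<bar>\<Omega> y\<bar> \<partial>lborel) = 0"
    proof (cases "m = 0")
      case True
      have "emeasure lborel F < \<infinity>"
        using F by (intro emeasure_bounded_finite bounded_subset[OF bounded_ball])
      with True F have "F \<in> null_sets lborel" by (auto simp: m_def measure_eq_0_null_sets emeasure_eq_ennreal_measure)
      then show ?thesis by (simp add: nn_integral_null_set)
    next
      case False
      with \<open>m = 0 \<or> N = 0\<close> have "N = 0" "0 < m" by (simp_all add: m_def zero_less_measure_iff)
      \<comment> \<open>No height is optimal when \<open>N = 0\<close>: let the height tend to \<open>0\<close>.\<close>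
      have "(\<integral>\<^sup>+y\<in>F. ennreal \<bar>\<Omega> y\<bar> \<partial>lborel) \<le> 0"
      proof (rule ennreal_le_epsilon)
        fix e :: real assume "0 < e"
        then show "(\<integral>\<^sup>+y\<in>F. ennreal \<bar>\<Omega> y\<bar> \<partial>lborel) \<le> 0 + ennreal e"
          using level[of "e / m"] \<open>0 < m\<close> \<open>N = 0\<close> by simp
      qed
      then show ?thesis by simp
    qed
    then show ?thesis by simp
  next
    case False
    then have m: "0 < m" and N: "0 < N"
      using N_nonneg by (auto simp: m_def zero_less_measure_iff)
    define c where "c = N * s powr \<alpha> * m powr - (\<alpha> / n)"
    have c: "0 < c" using N s m by (simp add: c_def)
    have cm: "c * m = N * s powr \<alpha> * m powr (1 - \<alpha> / n)"
      using m by (simp add: c_def powr_diff powr_minus field_simps)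
    have cq: "(N / c) powr q * s ^ DIM('a) = m"
    proof -
      have "N / c = (s powr - \<alpha>) * m powr (\<alpha> / n)"
        using N s m by (simp add: c_def powr_minus field_simps)
      then have "(N / c) powr q = (s powr - \<alpha>) powr q * (m powr (\<alpha> / n)) powr q"
        using s m by (simp add: powr_mult)
      also have "(s powr - \<alpha>) powr q = s powr - n"
        using alpha by (simp add: powr_powr q_def)
      also have "(m powr (\<alpha> / n)) powr q = m"
        using alpha n m by (simp add: powr_powr q_def)
      finally show ?thesis using s by (simp add: n_def powr_minus powr_realpow)
    qed
    have "s ^ DIM('a) * N powr q / n * (c powr - (q - 1) / (q - 1)) = c * m / (n * (q - 1))"
    proof -
      have "c powr - (q - 1) = c / c powr q" using c by (simp add: powr_diff)
      moreover have "N powr q / c powr q * s ^ DIM('a) = m"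
        using cq N c by (simp add: powr_divide)
      moreover have "s ^ DIM('a) * N powr q / n * (c / c powr q / (q - 1))
          = (N powr q / c powr q * s ^ DIM('a)) * (c / (n * (q - 1)))"
        by (simp add: mult_ac)
      ultimately show ?thesis by simp
    qed
    also have "\<dots> \<le> c * m / 1"
    proof -
      have "1 * 1 \<le> n * (q - 1)" using n q by (intro mult_mono) auto
      then show ?thesis using c m by (intro divide_left_mono) auto
    qed
    finally have "c * m + s ^ DIM('a) * N powr q / n * (c powr - (q - 1) / (q - 1))
        \<le> 2 * N * s powr \<alpha> * m powr (1 - \<alpha> / n)" by (simp add: cm)
    with level[OF c] show ?thesis
      by (auto simp: m_def n_def intro: order_trans ennreal_leI)
  qed
qed

lemma set_integrable_kernel:
  assumes [measurable]: "A \<in> sets borel" and "A \<subseteq> ball 0 s"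
  shows "set_integrable lborel A \<Omega>"
  unfolding set_integrable_def
proof (rule integrableI_bounded)
  let ?s = "max s 1"
  have "(\<integral>\<^sup>+y. ennreal (norm (indicat_real A y *\<^sub>R \<Omega> y)) \<partial>lborel) = (\<integral>\<^sup>+y\<in>A. ennreal \<bar>\<Omega> y\<bar> \<partial>lborel)"
    by (intro nn_integral_cong) (auto simp: indicator_def)
  also have "\<dots> \<le> ennreal (2 * N * ?s powr \<alpha> * measure lborel A powr (1 - \<alpha> / real DIM('a)))"
    using assms by (intro set_nn_integral_kernel_le) auto
  also have "\<dots> < \<infinity>" by simp
  finally show "(\<integral>\<^sup>+y. ennreal (norm (indicat_real A y *\<^sub>R \<Omega> y)) \<partial>lborel) < \<infinity>" .
qed measurable

lemma integral_ball_kernel: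
  assumes r: "0 < r"
  shows "(LINT y:ball 0 r|lborel. \<Omega> y) = 0"
proof -
  have "(LINT y:ball 0 r|lborel. \<Omega> y)
      = \<bar>r\<bar> ^ DIM('a) * (\<integral>y. indicat_real (ball 0 r) (r *\<^sub>R y) *\<^sub>R \<Omega> (r *\<^sub>R y) \<partial>lborel)"
    unfolding set_lebesgue_integral_def using r measurable_kernel
    by (intro lborel_integral_scale borel_measurable_scaleR borel_measurable_indicator) auto
  also have "(\<integral>y. indicat_real (ball 0 r) (r *\<^sub>R y) *\<^sub>R \<Omega> (r *\<^sub>R y) \<partial>lborel)
      = (LINT y:ball 0 1|lborel. \<Omega> y)"
    unfolding set_lebesgue_integral_def
    by (intro integral_cong_AE eventually_mono[OF AE_lborel_singleton[of 0]])
      (use r in \<open>auto simp: indicator_def kernel_scaleR\<close>)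
  finally show ?thesis by (simp add: mean_zero)
qed

lemma integral_shell_kernel:
  assumes t: "0 < t"
  shows "(LINT y:{y. t < norm y \<and> norm y < s}|lborel. \<Omega> y) = 0"
proof (cases "t < s")
  case True
  let ?S = "{y::'a. t < norm y \<and> norm y < s}"
  have "(LINT y:ball 0 t|lborel. \<Omega> y) = (LINT y:cball 0 t|lborel. \<Omega> y)"
    unfolding set_lebesgue_integral_def
    by (intro integral_cong_AE eventually_mono[OF AE_lborel_norm_neq[of t]])
      (auto simp: indicator_def)
  moreover have "(LINT y:?S \<union> cball 0 t|lborel. \<Omega> y)
      = (LINT y:?S|lborel. \<Omega> y) + (LINT y:cball 0 t|lborel. \<Omega> y)"
  proof (rule set_integral_Un)
    show "set_integrable lborel ?S \<Omega>"
      by (rule set_integrable_kernel[of _ s]) auto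
    show "set_integrable lborel (cball 0 t) \<Omega>"
      by (rule set_integrable_kernel[of _ s]) (use True in auto)
  qed auto
  moreover have "?S \<union> cball 0 t = ball 0 s" using True by auto
  ultimately show ?thesis using integral_ball_kernel[of t] integral_ball_kernel[of s] t True by simp
next
  case False
  then have "{y::'a. t < norm y \<and> norm y < s} = {}" by auto
  then show ?thesis by (simp only: set_lebesgue_integral_def) simp
qed

lemma abs_integral_kernel_le:
  assumes [measurable]: "A \<in> sets borel" and A: "A \<subseteq> F" "F \<subseteq> ball 0 s"
    and [measurable]: "F \<in> sets borel" and s: "0 < s"
  shows "\<bar>LINT y:A|lborel. \<Omega> y\<bar> \<le> 2 * N * s powr \<alpha> * measure lborel F powr (1 - \<alpha> / real DIM('a))"
proof -
  have "ennreal \<bar>LINT y:A|lborel. \<Omega> y\<bar> \<le> (\<integral>\<^sup>+y. ennreal (norm (indicat_real A y *\<^sub>R \<Omega> y)) \<partial>lborel)"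
    using integral_norm_bound_ennreal[of lborel "\<lambda>y. indicat_real A y *\<^sub>R \<Omega> y"]
      set_integrable_kernel[of A s] A
    by (simp add: set_lebesgue_integral_def set_integrable_def)
  also have "\<dots> \<le> (\<integral>\<^sup>+y\<in>F. ennreal \<bar>\<Omega> y\<bar> \<partial>lborel)"
    using A by (intro nn_integral_mono) (auto simp: indicator_def)
  also have "\<dots> \<le> ennreal (2 * N * s powr \<alpha> * measure lborel F powr (1 - \<alpha> / real DIM('a)))"
    using A s by (intro set_nn_integral_kernel_le) auto
  finally show ?thesis using N_nonneg by (subst (asm) ennreal_le_iff) auto
qed

text \<open>
  By cancellation on the shell, the integrals over the parts inside and outside \<open>E\<close> differ only in
  sign, so the weak bound may be applied to the smaller one; this is what the relative isoperimetric
  inequality can absorb.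
\<close>
lemma abs_integral_shell_le_frac_diff:
  assumes E [measurable]: "E \<in> sets borel" and t: "0 < t" and s: "0 < s"
  shows "ennreal \<bar>LINT y:{y \<in> E. t < norm y \<and> norm y < s}|lborel. \<Omega> y\<bar>
    \<le> ennreal (2 * N * isoperimetric_const TYPE('a) * (1 - \<alpha>) * s powr \<alpha>) *
      (\<integral>\<^sup>+y\<in>ball 0 (3 * s). frac_diff \<alpha> (indicat_real E) y \<partial>lborel)"
proof -
  let ?S = "{y::'a. t < norm y \<and> norm y < s}"
  let ?A = "{y \<in> E. t < norm y \<and> norm y < s}"
  let ?A' = "{y \<in> - E. t < norm y \<and> norm y < s}"
  let ?p = "1 - \<alpha> / real DIM('a)"
  let ?P = "\<integral>\<^sup>+y\<in>ball 0 (3 * s). frac_diff \<alpha> (indicat_real E) y \<partial>lborel"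
  define m where "m = min (measure lborel (E \<inter> ball 0 s)) (measure lborel (ball 0 s - E))"
  have "(LINT y:?A \<union> ?A'|lborel. \<Omega> y) = (LINT y:?A|lborel. \<Omega> y) + (LINT y:?A'|lborel. \<Omega> y)"
    by (intro set_integral_Un set_integrable_kernel[of _ s]) (auto, measurable)
  also have "?A \<union> ?A' = ?S" by auto
  finally have flip: "\<bar>LINT y:?A|lborel. \<Omega> y\<bar> = \<bar>LINT y:?A'|lborel. \<Omega> y\<bar>"
    by (simp add: integral_shell_kernel[OF t])
  have "\<bar>LINT y:?A|lborel. \<Omega> y\<bar> \<le> 2 * N * s powr \<alpha> * measure lborel (E \<inter> ball 0 s) powr ?p"
    by (rule abs_integral_kernel_le) (use s in auto)
  moreover have "\<bar>LINT y:?A|lborel. \<Omega> y\<bar> \<le> 2 * N * s powr \<alpha> * measure lborel (ball 0 s - E) powr ?p"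
    unfolding flip by (rule abs_integral_kernel_le) (use s in auto)
  ultimately have "\<bar>LINT y:?A|lborel. \<Omega> y\<bar> \<le> 2 * N * s powr \<alpha> * m powr ?p"
    by (simp add: m_def min_def)
  then have "ennreal \<bar>LINT y:?A|lborel. \<Omega> y\<bar> \<le> ennreal (2 * N * s powr \<alpha> * m powr ?p)"
    by (rule ennreal_leI)
  also have "\<dots> = ennreal (2 * N * s powr \<alpha>) * ennreal (m powr ?p)"
    using N_nonneg by (simp add: ennreal_mult)
  also have "\<dots> \<le> ennreal (2 * N * s powr \<alpha>) * (ennreal (isoperimetric_const TYPE('a) * (1 - \<alpha>)) * ?P)"
    unfolding m_def by (intro mult_left_mono relative_fractional_isoperimetric alpha E s) simp
  also have "\<dots> = ennreal (2 * N * isoperimetric_const TYPE('a) * (1 - \<alpha>) * s powr \<alpha>) * ?P"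
  proof -
    have "ennreal (2 * N * s powr \<alpha>) * ennreal (isoperimetric_const TYPE('a) * (1 - \<alpha>))
        = ennreal (2 * N * isoperimetric_const TYPE('a) * (1 - \<alpha>) * s powr \<alpha>)"
      using N_nonneg alpha
      by (subst ennreal_mult[symmetric]) (auto simp: isoperimetric_const_def intro!: arg_cong[where f=ennreal])
    then show ?thesis by (simp only: mult.assoc[symmetric])
  qed
  finally show ?thesis .
qed

end

section \<open>The coarea formula for the nonlinear fractional derivative\<close>

lemma frac_diff_lborel:
  "frac_diff \<alpha> g x
    = (\<integral>\<^sup>+y. ennreal (\<bar>g x - g y\<bar> / norm (x - y) powr (real DIM('a) + \<alpha>)) \<partial>lborel)"
  for x :: "'a::euclidean_space"
  by (simp add: frac_diff_def nn_integral_completion)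

lemma measurable_frac_diff [measurable]:
  fixes g :: "'a::euclidean_space \<Rightarrow> real"
  assumes [measurable]: "g \<in> borel_measurable borel"
  shows "frac_diff \<alpha> g \<in> borel_measurable borel"
  unfolding frac_diff_lborel[abs_def] by measurable

lemma frac_diff_superlevel_eq:
  fixes g :: "'a::euclidean_space \<Rightarrow> real"
  shows "frac_diff \<alpha> (indicat_real {z. u < g z}) y
    = (\<integral>\<^sup>+z. (if (u < g y) \<noteq> (u < g z) then 1 else 0) *
         ennreal (1 / norm (y - z) powr (real DIM('a) + \<alpha>)) \<partial>lborel)"
  unfolding frac_diff_lborel by (intro nn_integral_cong) (auto simp: indicator_def)

lemma measurable_frac_diff_superlevel [measurable]:
  fixes g :: "'a::euclidean_space \<Rightarrow> real"
  assumes [measurable]: "g \<in> borel_measurable borel"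
  shows "(\<lambda>(u, y). frac_diff \<alpha> (indicat_real {z. u < g z}) y) \<in> borel_measurable (borel \<Otimes>\<^sub>M borel)"
  unfolding frac_diff_superlevel_eq by measurable

text \<open>
  The levels \<open>u\<close> separating \<open>g y\<close> from \<open>g z\<close> form an interval of length \<open>|g y - g z|\<close>.
\<close>
lemma frac_diff_coarea:
  fixes g :: "'a::euclidean_space \<Rightarrow> real"
  assumes [measurable]: "g \<in> borel_measurable borel"
  shows "(\<integral>\<^sup>+u. frac_diff \<alpha> (indicat_real {z. u < g z}) y \<partial>lborel) = frac_diff \<alpha> g y"
proof -
  let ?J = "\<lambda>u z. if (u < g y) \<noteq> (u < g z) then 1 else (0::ennreal)"
  let ?k = "\<lambda>z. ennreal (1 / norm (y - z) powr (real DIM('a) + \<alpha>))"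
  have "(\<integral>\<^sup>+u. frac_diff \<alpha> (indicat_real {z. u < g z}) y \<partial>lborel)
      = (\<integral>\<^sup>+z. (\<integral>\<^sup>+u. ?J u z * ?k z \<partial>lborel) \<partial>lborel)"
    unfolding frac_diff_superlevel_eq
    by (rule lborel_pair.Fubini', rule measurable_lborel_pair) measurable
  also have "\<dots> = frac_diff \<alpha> g y"
    unfolding frac_diff_lborel
  proof (intro nn_integral_cong)
    fix z
    have "(\<integral>\<^sup>+u. ?J u z * ?k z \<partial>lborel)
        = (\<integral>\<^sup>+u. ?k z * indicator {min (g y) (g z)..<max (g y) (g z)} u \<partial>lborel)"
      by (intro nn_integral_cong) (auto simp: indicator_def)
    also have "\<dots> = ?k z * ennreal \<bar>g y - g z\<bar>"
      by (subst nn_integral_cmult_indicator) (auto simp: max_def min_def)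
    also have "\<dots> = ennreal (\<bar>g y - g z\<bar> / norm (y - z) powr (real DIM('a) + \<alpha>))"
      by (simp add: ennreal_mult[symmetric])
    finally show "(\<integral>\<^sup>+u. ?J u z * ?k z \<partial>lborel)
        = ennreal (\<bar>g y - g z\<bar> / norm (y - z) powr (real DIM('a) + \<alpha>))" .
  qed
  finally show ?thesis .
qed

lemma set_nn_integral_frac_diff_coarea:
  fixes g :: "'a::euclidean_space \<Rightarrow> real"
  assumes [measurable]: "g \<in> borel_measurable borel" "B \<in> sets borel"
  shows "(\<integral>\<^sup>+u. (\<integral>\<^sup>+y\<in>B. frac_diff \<alpha> (indicat_real {z. u < g z}) y \<partial>lborel) \<partial>lborel)
    = (\<integral>\<^sup>+y\<in>B. frac_diff \<alpha> g y \<partial>lborel)"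
proof -
  have "(\<integral>\<^sup>+u. (\<integral>\<^sup>+y\<in>B. frac_diff \<alpha> (indicat_real {z. u < g z}) y \<partial>lborel) \<partial>lborel)
      = (\<integral>\<^sup>+y. (\<integral>\<^sup>+u. frac_diff \<alpha> (indicat_real {z. u < g z}) y * indicator B y \<partial>lborel) \<partial>lborel)"
    unfolding frac_diff_superlevel_eq
    by (rule lborel_pair.Fubini', rule measurable_lborel_pair) measurable
  also have "\<dots> = (\<integral>\<^sup>+y\<in>B. frac_diff \<alpha> g y \<partial>lborel)"
  proof (intro nn_integral_cong)
    fix y
    have "(\<lambda>u. frac_diff \<alpha> (indicat_real {z. u < g z}) y) \<in> borel_measurable lborel"
      unfolding frac_diff_superlevel_eq by measurable
    then show "(\<integral>\<^sup>+u. frac_diff \<alpha> (indicat_real {z. u < g z}) y * indicator B y \<partial>lborel)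
        = frac_diff \<alpha> g y * indicator B y"
      by (simp add: nn_integral_multc frac_diff_coarea)
  qed
  finally show ?thesis .
qed

lemma measurable_set_nn_integral_superlevel:
  fixes g :: "'a::euclidean_space \<Rightarrow> real"
  assumes [measurable]: "g \<in> borel_measurable borel" "B \<in> sets borel"
  shows "(\<lambda>u. \<integral>\<^sup>+y\<in>B. frac_diff \<alpha> (indicat_real {z. u < g z}) y \<partial>lborel)
    \<in> borel_measurable borel"
proof -
  have "(\<lambda>(u, y). frac_diff \<alpha> (indicat_real {z. u < g z}) y * indicator B y)
      \<in> borel_measurable (borel \<Otimes>\<^sub>M lborel)"
    by measurable
  from lborel.borel_measurable_nn_integral[OF this] show ?thesis by simp
qed

section \<open>The truncated singular integral is dominated by a Riesz potential\<close>

context rough_kernel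
begin

text \<open>
  Mean zero on the shell allows \<open>g\<close> to be replaced by the nonnegative function \<open>g + M\<close>, whose layers
  are the superlevel sets of \<open>g\<close> at the levels \<open>u \<ge> - M\<close>.
\<close>
lemma abs_integral_shell_mult_le_frac_diff:
  assumes g [measurable]: "g \<in> borel_measurable borel" and M: "\<And>y. \<bar>g y\<bar> \<le> M"
    and t: "0 < t" and s: "0 < s"
  shows "ennreal \<bar>LINT y:{y. t < norm y \<and> norm y < s}|lborel. \<Omega> y * g y\<bar>
    \<le> ennreal (2 * N * isoperimetric_const TYPE('a) * (1 - \<alpha>) * s powr \<alpha>) *
      (\<integral>\<^sup>+y\<in>ball 0 (3 * s). frac_diff \<alpha> g y \<partial>lborel)"
proof -
  let ?S = "{y::'a. t < norm y \<and> norm y < s}"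
  let ?h = "\<lambda>y. indicat_real ?S y * \<Omega> y"
  let ?K = "\<lambda>y u. if - M \<le> u \<and> u < g y then 1 else (0::real)"
  let ?c = "ennreal (2 * N * isoperimetric_const TYPE('a) * (1 - \<alpha>) * s powr \<alpha>)"
  have [measurable]: "?S \<in> sets borel" by measurable
  have hint: "integrable lborel ?h"
  proof -
    have "set_integrable lborel ?S \<Omega>" by (rule set_integrable_kernel[of _ s]) auto
    then show ?thesis by (simp add: set_integrable_def)
  qed
  have hgint: "integrable lborel (\<lambda>y. ?h y * g y)"
  proof (rule Bochner_Integration.integrable_bound)
    show "integrable lborel (\<lambda>y. M * ?h y)" using hint by simp
    show "AE y in lborel. norm (?h y * g y) \<le> norm (M * ?h y)"
    proof (intro AE_I2)
      fix y
      have "\<bar>g y\<bar> * \<bar>?h y\<bar> \<le> \<bar>M\<bar> * \<bar>?h y\<bar>" using M[of y] by (intro mult_right_mono) auto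
      then show "norm (?h y * g y) \<le> norm (M * ?h y)" by (simp add: abs_mult mult_ac)
    qed
  qed measurable
  have "(\<integral>y. ?h y * (g y + M) \<partial>lborel) = (\<integral>y. ?h y * g y \<partial>lborel) + M * (\<integral>y. ?h y \<partial>lborel)"
    using hint hgint by (simp add: distrib_left mult.commute[of M])
  also have "(\<integral>y. ?h y \<partial>lborel) = 0"
    using integral_shell_kernel[OF t, of s] by (simp add: set_lebesgue_integral_def)
  finally have "(LINT y:?S|lborel. \<Omega> y * g y) = (\<integral>y. ?h y * (g y + M) \<partial>lborel)"
    by (simp add: set_lebesgue_integral_def mult.assoc)
  then have "ennreal \<bar>LINT y:?S|lborel. \<Omega> y * g y\<bar> = ennreal \<bar>\<integral>y. ?h y * (g y + M) \<partial>lborel\<bar>"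
    by simp
  also have "\<dots> \<le> (\<integral>\<^sup>+u. ennreal \<bar>\<integral>y. ?h y * ?K y u \<partial>lborel\<bar> \<partial>lborel)"
  proof (rule abs_integral_layer_le)
    show "(\<integral>\<^sup>+u. ennreal (?K y u) \<partial>lborel) = ennreal (g y + M)" for y
    proof -
      have "(\<integral>\<^sup>+u. ennreal (?K y u) \<partial>lborel) = (\<integral>\<^sup>+u. indicator {- M..<g y} u \<partial>lborel)"
        by (intro nn_integral_cong) (auto simp: indicator_def)
      also have "\<dots> = ennreal (g y + M)" using M[of y] by simp
      finally show ?thesis .
    qed
    show "0 \<le> g y + M" for y using M[of y] by (simp add: abs_le_iff)
    show "integrable lborel (\<lambda>y. ?h y * (g y + M))"
      using hint hgint by (simp add: distrib_left mult.commute[of M])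
    show "case_prod ?K \<in> borel_measurable (lborel \<Otimes>\<^sub>M lborel)"
      by (rule measurable_lborel_pair) measurable
  qed (auto intro: sigma_finite_lborel)
  also have "\<dots> \<le> (\<integral>\<^sup>+u. ?c * (\<integral>\<^sup>+y\<in>ball 0 (3 * s). frac_diff \<alpha> (indicat_real {z. u < g z}) y \<partial>lborel) \<partial>lborel)"
  proof (intro nn_integral_mono)
    fix u :: real
    let ?E = "{z. u < g z}"
    show "ennreal \<bar>\<integral>y. ?h y * ?K y u \<partial>lborel\<bar>
        \<le> ?c * (\<integral>\<^sup>+y\<in>ball 0 (3 * s). frac_diff \<alpha> (indicat_real ?E) y \<partial>lborel)"
    proof (cases "- M \<le> u")
      case True
      have "(\<integral>y. ?h y * ?K y u \<partial>lborel) = (LINT y:{y \<in> ?E. t < norm y \<and> norm y < s}|lborel. \<Omega> y)"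
        unfolding set_lebesgue_integral_def using True
        by (intro Bochner_Integration.integral_cong) (auto simp: indicator_def)
      moreover have "?E \<in> sets borel" by measurable
      ultimately show ?thesis using abs_integral_shell_le_frac_diff[of ?E t s] t s by simp
    qed simp
  qed
  also have "\<dots> = ?c * (\<integral>\<^sup>+u. (\<integral>\<^sup>+y\<in>ball 0 (3 * s). frac_diff \<alpha> (indicat_real {z. u < g z}) y \<partial>lborel) \<partial>lborel)"
    using measurable_set_nn_integral_superlevel[OF g, of "ball 0 (3 * s)" \<alpha>] by (intro nn_integral_cmult) simp
  also have "\<dots> = ?c * (\<integral>\<^sup>+y\<in>ball 0 (3 * s). frac_diff \<alpha> g y \<partial>lborel)"
    using set_nn_integral_frac_diff_coarea[OF g, of "ball 0 (3 * s)" \<alpha>] by simp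
  finally show ?thesis .
qed

text \<open>
  The kernel \<open>|y| powr - n\<close> is decomposed into the layers \<open>n * s powr (- n - 1)\<close> on \<open>|y| < s\<close>, so that
  only shell integrals of \<open>\<Omega> * g\<close> without a radial weight occur, for which the kernel has mean zero.
  Exchanging the integrals in the resulting bound, each \<open>y\<close> collects the radii
  \<open>s > |y| / 3\<close>, which gives \<open>n / (n - \<alpha>)\<close> times \<open>(|y| / 3) powr (\<alpha> - n)\<close>.
\<close>
proposition abs_truncated_integral_le_riesz_potential:
  assumes g [measurable]: "g \<in> borel_measurable borel" and M: "\<And>y. \<bar>g y\<bar> \<le> M"
    and supp: "\<And>y. R \<le> norm y \<Longrightarrow> g y = 0" and t: "0 < t"
  shows "ennreal \<bar>LINT y:{y. norm y > t}|lborel. \<Omega> y / norm y ^ DIM('a) * g y\<bar>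
    \<le> ennreal (4 * 3 ^ DIM('a) * isoperimetric_const TYPE('a) * (1 - \<alpha>) * N) *
      (\<integral>\<^sup>+y. ennreal (norm y powr (\<alpha> - real DIM('a))) * frac_diff \<alpha> g y \<partial>lborel)"
proof -
  define n where "n = real DIM('a)"
  define c where "c = 2 * N * isoperimetric_const TYPE('a) * (1 - \<alpha>)"
  have n: "2 \<le> n" using dim by (simp add: n_def)
  have c: "0 \<le> c" using N_nonneg alpha by (simp add: c_def isoperimetric_const_def)
  let ?S = "{y::'a. t < norm y \<and> norm y < R}"
  let ?h = "\<lambda>y. indicat_real {y. norm y > t} y * (\<Omega> y * g y)"
  let ?K = "\<lambda>(y::'a) s. if norm y < s then n * s powr (- n - 1) else (0::real)"
  have "(LINT y:{y. norm y > t}|lborel. \<Omega> y / norm y ^ DIM('a) * g y)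
      = (\<integral>y. ?h y * (1 / norm y ^ DIM('a)) \<partial>lborel)"
    unfolding set_lebesgue_integral_def by (intro Bochner_Integration.integral_cong) auto
  then have "ennreal \<bar>LINT y:{y. norm y > t}|lborel. \<Omega> y / norm y ^ DIM('a) * g y\<bar>
      = ennreal \<bar>\<integral>y. ?h y * (1 / norm y ^ DIM('a)) \<partial>lborel\<bar>" by simp
  also have "\<dots> \<le> (\<integral>\<^sup>+s. ennreal \<bar>\<integral>y. ?h y * ?K y s \<partial>lborel\<bar> \<partial>lborel)"
  proof (rule abs_integral_layer_le)
    fix y assume "?h y \<noteq> 0"
    then have y: "0 < norm y" using t by (auto simp: indicator_def split: if_splits)
    have "(\<integral>\<^sup>+s. ennreal (?K y s) \<partial>lborel)
        = (\<integral>\<^sup>+s. ennreal n * (ennreal (s powr (- n - 1)) * indicator {norm y<..} s) \<partial>lborel)"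
      using n by (intro nn_integral_cong) (auto simp: indicator_def ennreal_mult)
    also have "\<dots> = ennreal n * (\<integral>\<^sup>+s\<in>{norm y<..}. ennreal (s powr (- n - 1)) \<partial>lborel)"
      by (rule nn_integral_cmult) measurable
    also have "\<dots> = ennreal n * ennreal (norm y powr - n / n)"
      using n y by (subst nn_integral_powr_tail) auto
    also have "\<dots> = ennreal (1 / norm y ^ DIM('a))"
      using n y by (subst ennreal_mult[symmetric]) (auto simp: n_def powr_minus powr_realpow field_simps)
    finally show "(\<integral>\<^sup>+s. ennreal (?K y s) \<partial>lborel) = ennreal (1 / norm y ^ DIM('a))" .
  next
    show "integrable lborel (\<lambda>y. ?h y * (1 / norm y ^ DIM('a)))"
    proof (rule Bochner_Integration.integrable_bound)
      show "integrable lborel (\<lambda>y. M / t ^ DIM('a) * (indicat_real ?S y * \<Omega> y))"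
      proof -
        have "set_integrable lborel ?S \<Omega>" by (rule set_integrable_kernel[of _ R]) auto
        then have "integrable lborel (\<lambda>y. indicat_real ?S y * \<Omega> y)" by (simp add: set_integrable_def)
        then show ?thesis by (rule integrable_mult_right)
      qed
      show "AE y in lborel. norm (?h y * (1 / norm y ^ DIM('a)))
          \<le> norm (M / t ^ DIM('a) * (indicat_real ?S y * \<Omega> y))"
      proof (intro AE_I2)
        fix y :: 'a
        show "norm (?h y * (1 / norm y ^ DIM('a))) \<le> norm (M / t ^ DIM('a) * (indicat_real ?S y * \<Omega> y))"
        proof (cases "y \<in> ?S")
          case True
          have "\<bar>g y\<bar> / norm y ^ DIM('a) \<le> \<bar>M\<bar> / t ^ DIM('a)"
            using True t M[of y] by (intro frac_le power_mono) auto
          then have "\<bar>\<Omega> y\<bar> * (\<bar>g y\<bar> / norm y ^ DIM('a)) \<le> \<bar>\<Omega> y\<bar> * (\<bar>M\<bar> / t ^ DIM('a))"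
            by (intro mult_left_mono) auto
          then show ?thesis using True t by (simp add: abs_mult mult_ac)
        next
          case False
          then have h0: "?h y = 0" using supp[of y] by (auto simp: indicator_def)
          show ?thesis unfolding h0 by simp
        qed
      qed
    qed measurable
    show "case_prod ?K \<in> borel_measurable (lborel \<Otimes>\<^sub>M lborel)"
      by (rule measurable_lborel_pair) measurable
  qed (use n in \<open>auto intro: sigma_finite_lborel\<close>)
  also have "\<dots> \<le> (\<integral>\<^sup>+s. (\<integral>\<^sup>+y. ennreal (n * c) * ennreal (s powr (\<alpha> - n - 1)) *
      (if norm y < 3 * s then 1 else 0) * frac_diff \<alpha> g y \<partial>lborel) \<partial>lborel)"
  proof (intro nn_integral_mono)
    fix s :: real
    let ?I = "\<integral>\<^sup>+y\<in>ball 0 (3 * s). frac_diff \<alpha> g y \<partial>lborel"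
    show "ennreal \<bar>\<integral>y. ?h y * ?K y s \<partial>lborel\<bar> \<le> (\<integral>\<^sup>+y. ennreal (n * c) * ennreal (s powr (\<alpha> - n - 1)) *
      (if norm y < 3 * s then 1 else 0) * frac_diff \<alpha> g y \<partial>lborel)"
    proof (cases "0 < s")
      case True
      have "(\<integral>y. ?h y * ?K y s \<partial>lborel) = (\<integral>y. n * s powr (- n - 1) *
          (indicat_real {y. t < norm y \<and> norm y < s} y *\<^sub>R (\<Omega> y * g y)) \<partial>lborel)"
        by (intro Bochner_Integration.integral_cong) (auto simp: indicator_def)
      also have "\<dots> = n * s powr (- n - 1) * (LINT y:{y. t < norm y \<and> norm y < s}|lborel. \<Omega> y * g y)"
        unfolding set_lebesgue_integral_def by (rule integral_mult_right_zero)
      finally have "ennreal \<bar>\<integral>y. ?h y * ?K y s \<partial>lborel\<bar> = ennreal (n * s powr (- n - 1)) *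
          ennreal \<bar>LINT y:{y. t < norm y \<and> norm y < s}|lborel. \<Omega> y * g y\<bar>"
        using n by (simp add: abs_mult ennreal_mult)
      also have "\<dots> \<le> ennreal (n * s powr (- n - 1)) * (ennreal (c * s powr \<alpha>) * ?I)"
        unfolding c_def by (intro mult_left_mono abs_integral_shell_mult_le_frac_diff[OF g M t True]) simp
      also have "\<dots> = (ennreal (n * c) * ennreal (s powr (\<alpha> - n - 1))) * ?I"
      proof -
        have "n * s powr (- n - 1) * (c * s powr \<alpha>) = n * c * s powr (\<alpha> - n - 1)"
        proof -
          have "s powr (- n - 1) * s powr \<alpha> = s powr (\<alpha> - n - 1)"
            by (simp add: powr_add[symmetric] algebra_simps)
          then show ?thesis by (simp add: mult_ac)
        qed
        then have "ennreal (n * s powr (- n - 1)) * ennreal (c * s powr \<alpha>)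
            = ennreal (n * c) * ennreal (s powr (\<alpha> - n - 1))"
          using n c by (simp add: ennreal_mult[symmetric])
        then show ?thesis by (simp only: mult.assoc[symmetric])
      qed
      also have "\<dots> = (\<integral>\<^sup>+y. (ennreal (n * c) * ennreal (s powr (\<alpha> - n - 1))) *
          (frac_diff \<alpha> g y * indicator (ball 0 (3 * s)) y) \<partial>lborel)"
      proof (rule nn_integral_cmult[symmetric])
        have [measurable]: "ball (0::'a) (3 * s) \<in> sets lborel" by simp
        show "(\<lambda>y. frac_diff \<alpha> g y * indicator (ball 0 (3 * s)) y) \<in> borel_measurable lborel"
          by measurable
      qed
      also have "\<dots> = (\<integral>\<^sup>+y. ennreal (n * c) * ennreal (s powr (\<alpha> - n - 1)) *
          (if norm y < 3 * s then 1 else 0) * frac_diff \<alpha> g y \<partial>lborel)"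
        by (intro nn_integral_cong) (auto simp: indicator_def)
      finally show ?thesis by simp
    next
      case False
      have "?K y s = 0" for y :: 'a
      proof -
        have "\<not> norm y < s" using False norm_ge_zero[of y] by linarith
        then show ?thesis by simp
      qed
      then show ?thesis by simp
    qed
  qed
  also have "\<dots> = (\<integral>\<^sup>+y. (\<integral>\<^sup>+s. ennreal (n * c) * ennreal (s powr (\<alpha> - n - 1)) *
      (if norm y < 3 * s then 1 else 0) * frac_diff \<alpha> g y \<partial>lborel) \<partial>lborel)"
    by (rule lborel_pair.Fubini', rule measurable_lborel_pair) measurable
  also have "\<dots> \<le> (\<integral>\<^sup>+y. ennreal (2 * 3 ^ DIM('a) * c) *
      (ennreal (norm y powr (\<alpha> - n)) * frac_diff \<alpha> g y) \<partial>lborel)"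
  proof (intro nn_integral_mono_AE eventually_mono[OF AE_lborel_singleton[of 0]])
    fix y :: 'a assume "y \<noteq> 0"
    then have y: "0 < norm y / 3" by simp
    have "(\<integral>\<^sup>+s. ennreal (n * c) * ennreal (s powr (\<alpha> - n - 1)) *
        (if norm y < 3 * s then 1 else 0) * frac_diff \<alpha> g y \<partial>lborel)
      = (\<integral>\<^sup>+s. (ennreal (n * c) * frac_diff \<alpha> g y) *
        (ennreal (s powr (- (n - \<alpha>) - 1)) * indicator {norm y / 3<..} s) \<partial>lborel)"
      by (intro nn_integral_cong) (auto simp: indicator_def mult_ac)
    also have "\<dots> = (ennreal (n * c) * frac_diff \<alpha> g y) *
        (\<integral>\<^sup>+s\<in>{norm y / 3<..}. ennreal (s powr (- (n - \<alpha>) - 1)) \<partial>lborel)"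
      by (rule nn_integral_cmult) measurable
    also have "\<dots> = (ennreal (n * c) * frac_diff \<alpha> g y) * ennreal ((norm y / 3) powr - (n - \<alpha>) / (n - \<alpha>))"
      using y n alpha by (subst nn_integral_powr_tail) auto
    also have "\<dots> = ennreal (n * c * ((norm y / 3) powr - (n - \<alpha>) / (n - \<alpha>))) * frac_diff \<alpha> g y"
    proof -
      have "0 \<le> n * c" "0 \<le> (norm y / 3) powr - (n - \<alpha>) / (n - \<alpha>)"
        using n c alpha by auto
      from ennreal_mult[OF this] show ?thesis by (simp only: mult_ac)
    qed
    also have "\<dots> \<le> ennreal (2 * 3 ^ DIM('a) * c * norm y powr (\<alpha> - n)) * frac_diff \<alpha> g y"
    proof (intro mult_right_mono ennreal_leI)
      have "n / (n - \<alpha>) \<le> 2" using n alpha by (simp add: divide_le_eq)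
      moreover have "3 powr (n - \<alpha>) \<le> 3 powr n" using alpha by (intro powr_mono) auto
      ultimately have "n / (n - \<alpha>) * 3 powr (n - \<alpha>) \<le> 2 * 3 ^ DIM('a)"
        using n alpha by (intro mult_mono) (auto simp: n_def powr_realpow)
      then have "n / (n - \<alpha>) * 3 powr (n - \<alpha>) * (c * norm y powr (\<alpha> - n))
          \<le> 2 * 3 ^ DIM('a) * (c * norm y powr (\<alpha> - n))"
        using c by (intro mult_right_mono) auto
      moreover have "(norm y / 3) powr - (n - \<alpha>) = 3 powr (n - \<alpha>) * norm y powr (\<alpha> - n)"
      proof -
        have "(norm y / 3) powr (\<alpha> - n) = norm y powr (\<alpha> - n) / 3 powr (\<alpha> - n)"
          by (simp add: powr_divide)
        moreover have "3 powr (\<alpha> - n) = 1 / 3 powr (n - \<alpha>)"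
          using powr_minus_divide[of 3 "n - \<alpha>"] by simp
        ultimately show ?thesis by simp
      qed
      ultimately show "n * c * ((norm y / 3) powr - (n - \<alpha>) / (n - \<alpha>))
          \<le> 2 * 3 ^ DIM('a) * c * norm y powr (\<alpha> - n)"
        by (simp add: mult_ac)
    qed simp
    also have "\<dots> = ennreal (2 * 3 ^ DIM('a) * c) * (ennreal (norm y powr (\<alpha> - n)) * frac_diff \<alpha> g y)"
      using c by (simp add: ennreal_mult mult.assoc)
    finally show "(\<integral>\<^sup>+s. ennreal (n * c) * ennreal (s powr (\<alpha> - n - 1)) *
        (if norm y < 3 * s then 1 else 0) * frac_diff \<alpha> g y \<partial>lborel)
      \<le> ennreal (2 * 3 ^ DIM('a) * c) * (ennreal (norm y powr (\<alpha> - n)) * frac_diff \<alpha> g y)" .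
  qed
  also have "\<dots> = ennreal (2 * 3 ^ DIM('a) * c) *
      (\<integral>\<^sup>+y. ennreal (norm y powr (\<alpha> - n)) * frac_diff \<alpha> g y \<partial>lborel)"
    by (rule nn_integral_cmult) measurable
  also have "2 * 3 ^ DIM('a) * c = 4 * 3 ^ DIM('a) * isoperimetric_const TYPE('a) * (1 - \<alpha>) * N"
    by (simp add: c_def)
  finally show ?thesis by (simp only: n_def)
qed

end

section \<open>From the sphere to the unit ball\<close>

lemma integral_scale_measure:
  fixes f :: "'a \<Rightarrow> real"
  assumes [measurable]: "f \<in> borel_measurable M" and c: "0 \<le> c"
  shows "(\<integral>x. f x \<partial>scale_measure (ennreal c) M) = c * (\<integral>x. f x \<partial>M)"
proof -
  have "scale_measure (ennreal c) M = density M (\<lambda>_. ennreal c)"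
    by (rule measure_eqI) (simp_all add: emeasure_density nn_integral_cmult_indicator)
  then show ?thesis using c by (simp add: integral_density)
qed

abbreviation sphere_retract :: "'a::euclidean_space \<Rightarrow> 'a" where
  "sphere_retract y \<equiv> y /\<^sub>R norm y"

lemma sphere_retract_scaleR:
  assumes "0 < r"
  shows "sphere_retract (r *\<^sub>R y) = sphere_retract y"
proof -
  have "inverse (norm (r *\<^sub>R y)) * r = inverse (norm y)"
    using assms by (simp add: field_simps)
  then show ?thesis by (simp only: scaleR_scaleR)
qed

lemma homogeneous_deg0_retract:
  assumes "homogeneous_deg0 \<Omega>" "y \<noteq> 0"
  shows "\<Omega> (sphere_retract y) = \<Omega> y"
  using assms by (simp add: homogeneous_deg0_def)

text \<open>
  Surface measure before completion and before multiplication by the dimension.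
\<close>
definition cone_measure :: "'a::euclidean_space measure" where
  "cone_measure = distr (restrict_space lborel (ball 0 1 - {0})) (restrict_space borel (sphere 0 1))
     sphere_retract"

lemma sphere_measure_cone:
  "sphere_measure = completion (scale_measure (ennreal (real DIM('a))) (cone_measure :: 'a::euclidean_space measure))"
  by (simp add: sphere_measure_def cone_measure_def ennreal_of_nat_eq_real_of_nat)

lemma sets_cone_measure: "sets cone_measure = sets (restrict_space borel (sphere 0 1))"
  by (simp add: cone_measure_def)

lemma measurable_sphere_retract:
  "sphere_retract \<in> restrict_space lborel (ball 0 1 - {0})
    \<rightarrow>\<^sub>M restrict_space borel (sphere (0::'a::euclidean_space) 1)"
proof (rule measurable_restrict_space2)
  show "sphere_retract \<in> space (restrict_space lborel (ball 0 1 - {0})) \<rightarrow> sphere (0::'a) 1"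
    by (auto simp: space_restrict_space)
  have "sphere_retract \<in> borel_measurable (lborel :: 'a measure)" by measurable
  then show "sphere_retract \<in> restrict_space lborel (ball 0 1 - {0}) \<rightarrow>\<^sub>M (borel :: 'a measure)"
    by (rule measurable_restrict_space1)
qed

text \<open>
  The exceptional set is a cone. Its part in the unit ball is null by definition of the cone measure,
  and the dilates of this part by positive integers cover the rest.
\<close>
lemma AE_lebesgue_of_AE_cone_measure:
  fixes P :: "'a::euclidean_space \<Rightarrow> bool"
  assumes "AE \<theta> in cone_measure. P \<theta>"
  shows "AE y in lebesgue. y \<noteq> 0 \<longrightarrow> P (sphere_retract y)"
proof -
  have "AE y in restrict_space lborel (ball 0 1 - {0::'a}). P (sphere_retract y)"
    using assms measurable_sphere_retract unfolding cone_measure_def by (rule AE_distrD[rotated])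
  then have "AE y in lborel. y \<in> ball 0 1 - {0::'a} \<longrightarrow> P (sphere_retract y)"
    by (subst (asm) AE_restrict_space_iff) auto
  then have "AE y in lebesgue. y \<in> ball 0 1 - {0::'a} \<longrightarrow> P (sphere_retract y)"
    by (rule AE_completion)
  then have "{y \<in> ball 0 1 - {0::'a}. \<not> P (sphere_retract y)} \<in> null_sets lebesgue" (is "?Z \<in> _")
    by (subst (asm) completion.AE_iff_null_sets) (auto elim!: back_subst[of "\<lambda>A. A \<in> null_sets lebesgue"])
  then have "negligible ?Z" by (simp add: negligible_iff_null_sets)
  then have "negligible ((\<lambda>y. real (Suc k) *\<^sub>R y) ` ?Z)" for k
    by (intro negligible_differentiable_image_negligible) (auto intro!: derivative_intros simp: differentiable_on_def)
  then have "negligible (\<Union>k. (\<lambda>y. real (Suc k) *\<^sub>R y) ` ?Z)"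
    by (intro negligible_countable_Union) auto
  moreover have "{y. \<not> (y \<noteq> 0 \<longrightarrow> P (sphere_retract y))} \<subseteq> (\<Union>k. (\<lambda>y. real (Suc k) *\<^sub>R y) ` ?Z)"
  proof
    fix y assume y: "y \<in> {y. \<not> (y \<noteq> 0 \<longrightarrow> P (sphere_retract y))}"
    obtain k where k: "norm y < real k" using reals_Archimedean2 by blast
    then have k': "norm y < real (Suc k)" by simp
    have e: "sphere_retract (y /\<^sub>R real (Suc k)) = sphere_retract y"
      by (rule sphere_retract_scaleR) simp
    have "norm (y /\<^sub>R real (Suc k)) < 1"
      using k' by (simp add: divide_inverse[symmetric] mult.commute del: of_nat_Suc)
    then have "y /\<^sub>R real (Suc k) \<in> ball 0 1 - {0}" using y by (auto simp del: of_nat_Suc)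
    moreover have "\<not> P (sphere_retract (y /\<^sub>R real (Suc k)))" unfolding e using y by simp
    ultimately have "y /\<^sub>R real (Suc k) \<in> ?Z" by blast
    moreover have "y = real (Suc k) *\<^sub>R (y /\<^sub>R real (Suc k))" by simp
    ultimately show "y \<in> (\<Union>k. (\<lambda>y. real (Suc k) *\<^sub>R y) ` ?Z)" by blast
  qed
  ultimately have "negligible {y. \<not> (y \<noteq> 0 \<longrightarrow> P (sphere_retract y))}"
    by (rule negligible_subset)
  then show ?thesis
    by (subst completion.AE_iff_null_sets) (simp add: negligible_iff_null_sets)
qed

text \<open>
  A kernel on the sphere is measurable only for the completed surface measure; its Borel version,
  extended homogeneously, can be used in Tonelli's theorem for product measures. The extension has the
  value \<open>0\<close> at the origin, because the retraction maps the origin to itself, off the sphere.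
\<close>
lemma homogeneous_Borel_version:
  fixes \<Omega> :: "'a::euclidean_space \<Rightarrow> real"
  assumes meas: "\<Omega> \<in> borel_measurable sphere_measure" and hom: "homogeneous_deg0 \<Omega>"
  obtains \<Theta> where "\<Theta> \<in> borel_measurable borel" "homogeneous_deg0 \<Theta>"
    "AE y in lebesgue. \<Omega> y = \<Theta> y" "AE \<theta> in sphere_measure. \<Omega> \<theta> = \<Theta> \<theta>"
proof -
  let ?M = "scale_measure (ennreal (real DIM('a))) (cone_measure :: 'a measure)"
  obtain \<Omega>' where \<Omega>': "\<Omega>' \<in> borel_measurable ?M" "AE \<theta> in ?M. \<Omega> \<theta> = \<Omega>' \<theta>"
    using completion_ex_borel_measurable_real[of \<Omega> ?M] meas unfolding sphere_measure_cone by blast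
  have "\<Omega>' \<in> borel_measurable (restrict_space borel (sphere 0 1))"
    using \<Omega>'(1) by (simp add: sets_cone_measure cong: measurable_cong_sets)
  then have ind: "(\<lambda>\<theta>. indicat_real (sphere 0 1) \<theta> *\<^sub>R \<Omega>' \<theta>) \<in> borel_measurable borel"
    by (subst (asm) borel_measurable_restrict_space_iff) auto
  define \<Theta> where "\<Theta> y = indicat_real (sphere 0 1) (sphere_retract y) *\<^sub>R \<Omega>' (sphere_retract y)" for y
  have "sphere_retract \<in> borel \<rightarrow>\<^sub>M (borel :: 'a measure)" by measurable
  then have m: "\<Theta> \<in> borel_measurable borel"
    unfolding \<Theta>_def using ind by (rule measurable_compose)
  have \<Theta>\<Omega>': "\<Theta> \<theta> = \<Omega>' \<theta>" if "\<theta> \<in> sphere 0 1" for \<theta>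
    using that by (simp add: \<Theta>_def)
  have h: "homogeneous_deg0 \<Theta>"
    unfolding homogeneous_deg0_def \<Theta>_def by (intro allI impI) (simp only: sphere_retract_scaleR)
  have AE\<Theta>: "AE \<theta> in ?M. \<Omega> \<theta> = \<Theta> \<theta>"
    using \<Omega>'(2) AE_space
  proof eventually_elim
    case (elim \<theta>)
    then have "\<theta> \<in> sphere 0 1"
      using sets_eq_imp_space_eq[OF sets_cone_measure]
      by (auto simp: space_scale_measure space_restrict_space)
    with elim show ?case by (simp add: \<Theta>\<Omega>')
  qed
  then have "AE \<theta> in cone_measure. \<Omega> \<theta> = \<Theta> \<theta>"
  proof -
    have "null_sets ?M = null_sets cone_measure"
      by (auto simp: null_sets_def)
    with AE\<Theta> show ?thesis by (auto simp: eventually_ae_filter space_scale_measure)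
  qed
  from AE_lebesgue_of_AE_cone_measure[OF this]
  have "AE y in lebesgue. y \<noteq> 0 \<longrightarrow> \<Omega> y = \<Theta> y"
    by eventually_elim (simp add: homogeneous_deg0_retract[OF hom] homogeneous_deg0_retract[OF h])
  moreover have "AE y in lebesgue. y \<noteq> (0::'a)"
    by (rule AE_completion) (rule AE_lborel_singleton)
  ultimately have "AE y in lebesgue. \<Omega> y = \<Theta> y" by eventually_elim simp
  moreover have "AE \<theta> in sphere_measure. \<Omega> \<theta> = \<Theta> \<theta>"
    unfolding sphere_measure_cone using AE\<Theta> by (rule AE_completion)
  ultimately show ?thesis using that m h by blast
qed

lemma measurable_sphere_measure:
  fixes f :: "'a::euclidean_space \<Rightarrow> real"
  assumes "f \<in> borel_measurable borel"
  shows "f \<in> borel_measurable sphere_measure"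
  unfolding sphere_measure_cone
proof (rule measurable_completion)
  show "f \<in> borel_measurable (scale_measure (ennreal (real DIM('a))) cone_measure)"
    using measurable_restrict_space1[OF assms, of "sphere 0 1"]
    by (simp add: sets_cone_measure cong: measurable_cong_sets)
qed

lemma integral_sphere_measure:
  fixes f :: "'a::euclidean_space \<Rightarrow> real"
  assumes f [measurable]: "f \<in> borel_measurable borel" and hom: "homogeneous_deg0 f"
  shows "(LINT \<theta>|sphere_measure. f \<theta>) = real DIM('a) * (LINT y:ball 0 1|lborel. f y)"
proof -
  have fc: "f \<in> borel_measurable cone_measure"
    using measurable_restrict_space1[OF f, of "sphere 0 1"]
    by (simp add: sets_cone_measure cong: measurable_cong_sets)
  have "(LINT \<theta>|sphere_measure. f \<theta>) = real DIM('a) * (LINT \<theta>|cone_measure. f \<theta>)"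
    unfolding sphere_measure_cone using fc
    by (simp add: integral_completion integral_scale_measure)
  also have "(LINT \<theta>|cone_measure. f \<theta>)
      = (LINT y|restrict_space lborel (ball 0 1 - {0}). f (sphere_retract y))"
    unfolding cone_measure_def
    by (intro integral_distr measurable_sphere_retract measurable_restrict_space1 f)
  also have "\<dots> = (LINT y:ball 0 1 - {0}|lborel. f (sphere_retract y))"
    by (subst integral_restrict_space) (auto simp: set_lebesgue_integral_def)
  also have "\<dots> = (LINT y:ball 0 1|lborel. f y)"
    unfolding set_lebesgue_integral_def
    by (intro integral_cong_AE eventually_mono[OF AE_lborel_singleton[of 0]])
      (auto simp: indicator_def homogeneous_deg0_retract[OF hom])
  finally show ?thesis .
qed

text \<open>
  The part in the unit ball of the cone over a superlevel set on the sphere is the superlevel set of the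
  homogeneous extension there, up to the origin.
\<close>
lemma emeasure_level_le_weak_norm:
  fixes \<Omega> \<Theta> :: "'a::euclidean_space \<Rightarrow> real"
  assumes p: "0 < p" and \<Omega>: "in_weak_Lp p \<Omega>"
    and \<Theta> [measurable]: "\<Theta> \<in> borel_measurable borel" and hom: "homogeneous_deg0 \<Theta>"
    and ae: "AE \<theta> in sphere_measure. \<Omega> \<theta> = \<Theta> \<theta>" and u: "0 < u"
  shows "emeasure lborel {y \<in> ball 0 1. \<bar>\<Theta> y\<bar> > u}
    \<le> ennreal ((enn2real (weak_Lp_norm p \<Omega>) / u) powr p / real DIM('a))"
proof -
  define N where "N = enn2real (weak_Lp_norm p \<Omega>)"
  define n where "n = real DIM('a)"
  have n: "0 < n" by (simp add: n_def)
  have N: "weak_Lp_norm p \<Omega> = ennreal N" "0 \<le> N"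
    using \<Omega> by (simp_all add: N_def in_weak_Lp_def)
  let ?S = "{\<theta> \<in> sphere 0 1. \<bar>\<Theta> \<theta>\<bar> > u}"
  let ?B = "{y \<in> ball 0 1. \<bar>\<Theta> y\<bar> > u}"
  have [measurable]: "?S \<in> sets borel" by measurable
  have spc: "space sphere_measure = sphere (0::'a) 1"
    using sets_eq_imp_space_eq[OF sets_cone_measure[where 'a='a]]
    by (simp add: sphere_measure_cone space_scale_measure space_restrict_space)
  have "emeasure sphere_measure ?S = of_nat DIM('a) * emeasure lborel {x \<in> ball 0 1 - {0}. x /\<^sub>R norm x \<in> ?S}"
    by (rule emeasure_sphere_measure) auto
  also have "{x \<in> ball 0 1 - {0}. x /\<^sub>R norm x \<in> ?S} = {y \<in> ball 0 1 - {0}. \<bar>\<Theta> y\<bar> > u}"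
    using homogeneous_deg0_retract[OF hom] by auto
  also have "emeasure lborel {y \<in> ball 0 1 - {0}. \<bar>\<Theta> y\<bar> > u} = emeasure lborel ?B"
    by (intro emeasure_eq_AE eventually_mono[OF AE_lborel_singleton[of 0]]) auto
  also have fin: "emeasure lborel ?B = ennreal (measure lborel ?B)"
  proof (intro emeasure_eq_ennreal_measure)
    have "bounded ?B" by (rule bounded_subset[OF bounded_ball[of 0 1]]) auto
    then show "emeasure lborel ?B \<noteq> top" using emeasure_bounded_finite by (auto simp: less_top)
  qed
  finally have "emeasure sphere_measure ?S = ennreal (n * measure lborel ?B)"
    by (simp add: n_def ennreal_mult ennreal_of_nat_eq_real_of_nat)
  then have "measure sphere_measure ?S = n * measure lborel ?B"
    using n by (simp add: measure_def)
  also have "measure sphere_measure ?S = measure sphere_measure {\<theta> \<in> sphere 0 1. \<bar>\<Omega> \<theta>\<bar> > u}"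
  proof (rule measure_eq_AE)
    show "AE \<theta> in sphere_measure. \<theta> \<in> ?S \<longleftrightarrow> \<theta> \<in> {\<theta> \<in> sphere 0 1. \<bar>\<Omega> \<theta>\<bar> > u}"
      using ae by eventually_elim simp
    have [measurable]: "\<Omega> \<in> borel_measurable sphere_measure" "\<Theta> \<in> borel_measurable sphere_measure"
      using \<Omega> measurable_sphere_measure[OF \<Theta>] by (simp_all add: in_weak_Lp_def)
    have "{\<theta> \<in> space sphere_measure. \<bar>\<Theta> \<theta>\<bar> > u} \<in> sets sphere_measure"
      "{\<theta> \<in> space sphere_measure. \<bar>\<Omega> \<theta>\<bar> > u} \<in> sets sphere_measure" by measurable
    then show "?S \<in> sets sphere_measure" "{\<theta> \<in> sphere 0 1. \<bar>\<Omega> \<theta>\<bar> > u} \<in> sets sphere_measure"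
      by (simp_all add: spc)
  qed
  finally have eq: "measure sphere_measure {\<theta> \<in> sphere 0 1. \<bar>\<Omega> \<theta>\<bar> > u} = n * measure lborel ?B" .
  have "ennreal (u * (n * measure lborel ?B) powr (1 / p)) \<le> ennreal N"
    unfolding N(1)[symmetric] weak_Lp_norm_def eq[symmetric] using u by (intro SUP_upper) simp
  then have "(n * measure lborel ?B) powr (1 / p) \<le> N / u"
    using N u by (simp add: field_simps)
  then have "((n * measure lborel ?B) powr (1 / p)) powr p \<le> (N / u) powr p"
    using p by (intro powr_mono2) auto
  then have "n * measure lborel ?B \<le> (N / u) powr p"
    using p n by (simp add: powr_powr)
  then have "measure lborel ?B \<le> (N / u) powr p / n"
    using n by (simp add: field_simps)
  then show ?thesis unfolding fin N_def n_def by (rule ennreal_leI)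
qed

section \<open>Muckenhoupt weights and the Riesz potential\<close>

lemma weight_measure_mono:
  assumes w: "weight w" and "A \<in> sets lebesgue" "B \<in> sets lebesgue" "A \<subseteq> B" "B \<subseteq> cball x R"
  shows "weight_measure w A \<le> weight_measure w B"
proof -
  have "set_integrable lebesgue (cball x R) w" using w by (simp add: weight_def)
  then have "set_integrable lebesgue A w" "set_integrable lebesgue B w"
    using assms by (auto intro: set_integrable_subset)
  then show ?thesis
    unfolding weight_measure_def set_lebesgue_integral_def set_integrable_def
    using assms by (intro integral_mono) (auto simp: indicator_def weight_def)
qed

lemma weight_measure_ball_le_0_imp_AE:
  fixes w :: "'a::euclidean_space \<Rightarrow> real"
  assumes w: "weight w" and le: "weight_measure w (ball x r) \<le> 0"
  shows "AE y in lebesgue. y \<in> ball x r \<longrightarrow> w y = 0"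
proof -
  have "set_integrable lebesgue (cball x r) w" using w by (simp add: weight_def)
  then have int: "set_integrable lebesgue (ball x r) w"
    by (rule set_integrable_subset) auto
  have nn: "AE y in lebesgue. 0 \<le> indicat_real (ball x r) y *\<^sub>R w y"
    using w by (simp add: weight_def)
  have "(LINT y|lebesgue. indicat_real (ball x r) y *\<^sub>R w y) = 0"
    using le integral_nonneg_AE[OF nn] by (simp add: weight_measure_def set_lebesgue_integral_def)
  then have "AE y in lebesgue. indicat_real (ball x r) y *\<^sub>R w y = 0"
    using integral_nonneg_eq_0_iff_AE[OF _ nn] int by (simp add: set_integrable_def)
  then show ?thesis by eventually_elim (simp add: indicator_def)
qed

text \<open>
  If \<open>w\<close> vanished on a ball, the condition \<open>A\<^sub>1\<close> at almost every point of it would make the means of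
  \<open>w\<close> over all larger concentric balls vanish, and then \<open>w\<close> itself. Positivity matters because the
  quotient in \<open>T_weight\<close> would otherwise take the default value \<open>0\<close>.
\<close>
lemma A1_weight_ball_pos:
  fixes w :: "'a::euclidean_space \<Rightarrow> real"
  assumes A1: "A1_weight w" and r: "0 < r"
  shows "0 < weight_measure w (ball x r)"
proof (rule ccontr)
  assume "\<not> 0 < weight_measure w (ball x r)"
  then have le: "weight_measure w (ball x r) \<le> 0" by simp
  have w: "weight w" using A1 by (simp add: A1_weight_def)
  have zero: "AE y in lebesgue. y \<in> ball x r \<longrightarrow> w y = 0"
    by (rule weight_measure_ball_le_0_imp_AE[OF w le])
  have "AE y in lebesgue. y \<in> ball x (r + real k) \<longrightarrow> w y = 0" for k
  proof (rule weight_measure_ball_le_0_imp_AE[OF w], rule ccontr)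
    let ?B = "ball x (r + real k)"
    assume "\<not> weight_measure w ?B \<le> 0"
    moreover have "0 < measure lebesgue ?B" using r by (simp add: content_ball_pos)
    ultimately have pos: "0 < weight_measure w ?B / measure lebesgue ?B" by simp
    have "AE y in lebesgue. y \<in> ?B \<longrightarrow> weight_measure w ?B / measure lebesgue ?B \<le> A1_const w * w y"
      using A1_const_least(1)[OF A1] r by (simp add: A1_bound_def)
    with zero have "AE y in lebesgue. y \<notin> ball x r"
    proof eventually_elim
      case (elim y)
      then show ?case using pos by auto
    qed
    then have "ball x r \<in> null_sets lebesgue"
      using AE_iff_null_sets[of "ball x r" lebesgue] by simp
    then have "measure lebesgue (ball x r) = 0" by (auto simp: null_sets_def measure_def)
    with r show False using content_ball_pos[of r x] by simp
  qed
  then have "AE y in lebesgue. \<forall>k. y \<in> ball x (r + real k) \<longrightarrow> w y = 0"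
    unfolding AE_all_countable by blast
  then have "AE y in lebesgue. w y = 0"
  proof eventually_elim
    case (elim y)
    obtain k where "dist x y < real k" using reals_Archimedean2 by blast
    with r have "y \<in> ball x (r + real k)" by simp
    with elim show ?case by blast
  qed
  with w show False by (simp add: weight_def)
qed

text \<open>
  The point \<open>y\<close> lies on the boundary of its ball, and the ball depends on \<open>y\<close>, so the condition \<open>A\<^sub>1\<close>
  does not apply directly. It holds almost everywhere for all balls of rational radius about \<open>x\<close>
  simultaneously, and these radii can be taken to decrease to \<open>|x - y|\<close>.
\<close>
lemma A1_weight_AE_ball_through_point:
  fixes w :: "'a::euclidean_space \<Rightarrow> real"
  assumes A1: "A1_weight w"
  shows "AE y in lebesgue. weight_measure w (ball x (norm (x - y)))
    \<le> A1_const w * unit_ball_vol (real DIM('a)) * norm (x - y) ^ DIM('a) * w y"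
proof -
  have w: "weight w" using A1 by (simp add: A1_weight_def)
  let ?C = "A1_const w" and ?\<omega> = "unit_ball_vol (real DIM('a))"
  have "AE y in lebesgue. \<forall>\<rho>\<in>{\<rho>\<in>\<rat>. 0 < \<rho>}. y \<in> ball x \<rho> \<longrightarrow>
      weight_measure w (ball x \<rho>) / measure lebesgue (ball x \<rho>) \<le> ?C * w y"
  proof -
    have "countable {\<rho>. \<rho> \<in> \<rat> \<and> 0 < (\<rho>::real)}"
      by (rule countable_subset[OF _ countable_rat]) auto
    then show ?thesis
    proof (rule AE_ball_countable'[rotated])
      fix \<rho> :: real assume "\<rho> \<in> {\<rho>. \<rho> \<in> \<rat> \<and> 0 < \<rho>}"
      then have "0 < \<rho>" by simp
      with A1_const_least(1)[OF A1]
      show "AE y in lebesgue. y \<in> ball x \<rho> \<longrightarrow>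
          weight_measure w (ball x \<rho>) / measure lebesgue (ball x \<rho>) \<le> ?C * w y"
        unfolding A1_bound_def by blast
    qed
  qed
  then show ?thesis
  proof eventually_elim
    case (elim y)
    let ?r = "norm (x - y)"
    have "\<exists>\<rho>\<in>\<rat>. ?r < \<rho> \<and> \<rho> < ?r + 1 / real (Suc k)" for k
      by (rule Rats_dense_in_real) simp
    then obtain \<rho> where \<rho>: "\<And>k. \<rho> k \<in> \<rat>" "\<And>k. ?r < \<rho> k" "\<And>k. \<rho> k < ?r + 1 / real (Suc k)"
      by metis
    have bound: "weight_measure w (ball x ?r) \<le> ?C * ?\<omega> * \<rho> k ^ DIM('a) * w y" for k
    proof -
      have pos: "0 < \<rho> k" using \<rho>(2)[of k] norm_ge_zero[of "x - y"] by linarith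
      have "y \<in> ball x (\<rho> k)" using \<rho>(2)[of k] by (simp add: dist_norm)
      then have "weight_measure w (ball x (\<rho> k)) / measure lebesgue (ball x (\<rho> k)) \<le> ?C * w y"
        using elim \<rho>(1) pos by blast
      moreover have "measure lebesgue (ball x (\<rho> k)) = ?\<omega> * \<rho> k ^ DIM('a)"
        using pos content_ball[of "\<rho> k" x] by simp
      ultimately have "weight_measure w (ball x (\<rho> k)) \<le> ?C * w y * (?\<omega> * \<rho> k ^ DIM('a))"
        using pos by (simp add: pos_divide_le_eq)
      moreover have "weight_measure w (ball x ?r) \<le> weight_measure w (ball x (\<rho> k))"
        using \<rho>(2)[of k] by (intro weight_measure_mono[OF w, of _ _ x "\<rho> k"]) auto
      ultimately show ?thesis by (simp add: mult_ac)
    qed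
    have "\<rho> \<longlonglongrightarrow> ?r"
    proof (rule tendsto_sandwich)
      show "\<forall>\<^sub>F k in sequentially. ?r \<le> \<rho> k"
        using \<rho>(2) by (intro always_eventually allI less_imp_le)
      show "\<forall>\<^sub>F k in sequentially. \<rho> k \<le> ?r + 1 / real (Suc k)"
        using \<rho>(3) by (intro always_eventually allI less_imp_le)
      show "(\<lambda>k. ?r + 1 / real (Suc k)) \<longlonglongrightarrow> ?r"
        using tendsto_add[OF tendsto_const LIMSEQ_Suc[OF lim_1_over_n], of ?r] by simp
    qed simp
    then have "(\<lambda>k. ?C * ?\<omega> * \<rho> k ^ DIM('a) * w y) \<longlonglongrightarrow> ?C * ?\<omega> * ?r ^ DIM('a) * w y"
      by (intro tendsto_intros)
    then show ?case
      by (rule LIMSEQ_le_const) (use bound in auto)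
  qed
qed

text \<open>
  Integrate \<open>A1_weight_AE_ball_through_point\<close>, solved for \<open>|x - y| powr - n\<close>, against
  \<open>|x - y| powr \<alpha> * h y\<close>. The constant is first divided out on the left, because linearity
  of the integral calls for a measurable integrand: on the left it is Borel, whereas that of
  \<open>T_weight\<close> contains the measures of a whole family of balls.
\<close>
lemma riesz_potential_le_T_weight:
  fixes w :: "'a::euclidean_space \<Rightarrow> real"
  assumes A1: "A1_weight w" and h [measurable]: "h \<in> borel_measurable borel"
  shows "(\<integral>\<^sup>+y. ennreal (norm (x - y) powr (\<alpha> - real DIM('a))) * h y \<partial>lborel)
    \<le> ennreal (A1_const w * unit_ball_vol (real DIM('a))) * T_weight w \<alpha> h x"
proof -
  let ?C = "A1_const w * unit_ball_vol (real DIM('a))"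
  let ?I = "\<integral>\<^sup>+y. ennreal (norm (x - y) powr (\<alpha> - real DIM('a))) * h y \<partial>lborel"
  have C: "0 < ?C"
    using A1_bound_pos[of w "A1_const w"] A1_const_least(1)[OF A1] A1 by (simp add: A1_weight_def)
  have w: "0 \<le> w y" for y using A1 by (simp add: A1_weight_def weight_def)
  have "ennreal (1 / ?C) * ?I
      = (\<integral>\<^sup>+y. ennreal (1 / ?C) * (ennreal (norm (x - y) powr (\<alpha> - real DIM('a))) * h y) \<partial>lborel)"
    by (rule nn_integral_cmult[symmetric]) measurable
  also have "\<dots> = (\<integral>\<^sup>+y. ennreal (1 / ?C) * (ennreal (norm (x - y) powr (\<alpha> - real DIM('a))) * h y) \<partial>lebesgue)"
    by (rule nn_integral_completion[symmetric])
  also have "\<dots> \<le> T_weight w \<alpha> h x"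
    unfolding T_weight_def
  proof (intro nn_integral_mono_AE)
    have "AE y in lebesgue. y \<noteq> x"
      by (rule AE_completion) (rule AE_lborel_singleton)
    with A1_weight_AE_ball_through_point[OF A1, of x]
    show "AE y in lebesgue. ennreal (1 / ?C) * (ennreal (norm (x - y) powr (\<alpha> - real DIM('a))) * h y)
        \<le> ennreal (norm (x - y) powr \<alpha> / weight_measure w (ball x (norm (x - y)))) * h y * ennreal (w y)"
    proof eventually_elim
      case (elim y)
      let ?r = "norm (x - y)" and ?W = "weight_measure w (ball x (norm (x - y)))"
      have r: "0 < ?r" using elim by simp
      have W: "0 < ?W" by (rule A1_weight_ball_pos[OF A1 r])
      have "1 / ?C * ?r powr (\<alpha> - real DIM('a)) = ?r powr \<alpha> / ?W * (?W / (?C * ?r ^ DIM('a)))"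
        using W r by (simp add: powr_diff powr_realpow)
      also have "\<dots> \<le> ?r powr \<alpha> / ?W * w y"
      proof (rule mult_left_mono)
        have "0 < ?C * ?r ^ DIM('a)" by (rule mult_pos_pos[OF C zero_less_power[OF r]])
        then show "?W / (?C * ?r ^ DIM('a)) \<le> w y"
          using elim by (subst pos_divide_le_eq) (auto simp: mult_ac)
      qed (use W in simp)
      finally have "ennreal (1 / ?C * ?r powr (\<alpha> - real DIM('a))) \<le> ennreal (?r powr \<alpha> / ?W * w y)"
        by (rule ennreal_leI)
      then have "ennreal (1 / ?C) * ennreal (?r powr (\<alpha> - real DIM('a)))
          \<le> ennreal (?r powr \<alpha> / ?W) * ennreal (w y)"
      proof -
        have "0 \<le> 1 / ?C" using C by (simp only: zero_le_divide_1_iff less_imp_le)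
        moreover have "0 \<le> ?r powr \<alpha> / ?W" using W by simp
        ultimately show ?thesis
          using \<open>ennreal (1 / ?C * ?r powr (\<alpha> - real DIM('a))) \<le> _\<close> w
          by (simp only: ennreal_mult powr_ge_zero)
      qed
      from mult_right_mono[OF this, of "h y"] show ?case by (simp add: mult_ac)
    qed
  qed
  finally have "ennreal ?C * (ennreal (1 / ?C) * ?I) \<le> ennreal ?C * T_weight w \<alpha> h x"
    by (intro mult_left_mono) auto
  moreover have "ennreal ?C * (ennreal (1 / ?C) * ?I) = ?I"
  proof -
    have "ennreal ?C * ennreal (1 / ?C) = 1"
      using C by (subst ennreal_mult[symmetric]) auto
    then show ?thesis by (simp only: mult.assoc[symmetric]) simp
  qed
  ultimately show ?thesis by simp
qed

section \<open>Pointwise domination of the maximal rough singular integral\<close>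

lemma frac_diff_reflect:
  fixes f :: "'a::euclidean_space \<Rightarrow> real"
  assumes [measurable]: "f \<in> borel_measurable borel"
  shows "frac_diff \<alpha> (\<lambda>y. f (x - y)) y = frac_diff \<alpha> f (x - y)"
proof -
  let ?F = "\<lambda>z. ennreal (\<bar>f (x - y) - f z\<bar> / norm ((x - y) - z) powr (real DIM('a) + \<alpha>))"
  have "frac_diff \<alpha> (\<lambda>y. f (x - y)) y = (\<integral>\<^sup>+z. ?F (x - z) \<partial>lborel)"
    unfolding frac_diff_lborel by (intro nn_integral_cong) (simp add: norm_minus_commute)
  also have "\<dots> = (\<integral>\<^sup>+z. ?F z \<partial>lborel)"
    by (rule nn_integral_lborel_reflect) measurable
  finally show ?thesis by (simp add: frac_diff_lborel)
qed

lemma smooth_compact_support_bounds: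
  fixes f :: "'a::euclidean_space \<Rightarrow> real"
  assumes "smooth_compact_support f"
  obtains M R where "continuous_on UNIV f" "\<And>y. \<bar>f y\<bar> \<le> M" "\<And>y. R \<le> norm y \<Longrightarrow> f y = 0"
proof -
  let ?K = "closure {x. f x \<noteq> 0}"
  have "C_diff 0 f" "compact ?K" using assms by (auto simp: smooth_compact_support_def)
  then have cont: "continuous_on UNIV f" and K: "compact ?K" by simp_all
  obtain R where R: "\<And>y. y \<in> ?K \<Longrightarrow> norm y \<le> R"
    using compact_imp_bounded[OF K] by (auto simp: bounded_iff)
  have "compact (f ` ?K)"
    using cont K by (intro compact_continuous_image continuous_on_subset[OF cont]) auto
  then obtain M where M: "\<And>y. y \<in> ?K \<Longrightarrow> \<bar>f y\<bar> \<le> M"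
    using compact_imp_bounded by (fastforce simp: bounded_iff)
  have supp: "y \<in> ?K" if "f y \<noteq> 0" for y
    using that closure_subset[of "{x. f x \<noteq> 0}"] by auto
  have "\<bar>f y\<bar> \<le> \<bar>M\<bar>" for y
    using M[OF supp, of y] by (cases "f y = 0") auto
  moreover have "f y = 0" if "R + 1 \<le> norm y" for y
    using R[OF supp, of y] that by fastforce
  ultimately show ?thesis using that cont by blast
qed

text \<open>
  The kernel is replaced by its Borel version, and the Riesz potential bound is applied to the
  reflected function \<open>f (x - y)\<close>, whose fractional derivative is the reflection of that of \<open>f\<close>.
\<close>
theorem theorem2p10:
  assumes "CARD('n::finite) \<ge> 2"
  shows "\<exists>c>0. \<forall>(\<alpha>::real) (w :: real^'n \<Rightarrow> real) (\<Omega> :: real^'n \<Rightarrow> real).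
    0 < \<alpha> \<longrightarrow> \<alpha> < 1 \<longrightarrow> A1_weight w \<longrightarrow>
    homogeneous_deg0 \<Omega> \<longrightarrow> zero_average \<Omega> \<longrightarrow> in_weak_Lp (real CARD('n) / \<alpha>) \<Omega> \<longrightarrow>
    (\<forall>(f :: real^'n \<Rightarrow> real) x. smooth_compact_support f \<longrightarrow>
      T_star \<Omega> f x \<le>
        ennreal (c * (1 - \<alpha>)) * weak_Lp_norm (real CARD('n) / \<alpha>) \<Omega> * ennreal (A1_const w)
          * T_weight w \<alpha> (frac_diff \<alpha> f) x)"
proof -
  let ?\<kappa> = "4 * 3 ^ CARD('n) * isoperimetric_const TYPE(real^'n)"
  let ?c = "?\<kappa> * unit_ball_vol (real CARD('n))"
  have iso: "0 < isoperimetric_const TYPE(real^'n)" by (rule isoperimetric_const_pos)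
  then have \<kappa>: "0 < ?\<kappa>" by simp
  have c: "0 < ?c" using \<kappa> by simp
  show ?thesis
  proof (intro exI[of _ ?c] conjI c allI impI)
    fix \<alpha> :: real and w \<Omega> f :: "real^'n \<Rightarrow> real" and x :: "real^'n"
    assume \<alpha>: "0 < \<alpha>" "\<alpha> < 1" and A1: "A1_weight w" and hom: "homogeneous_deg0 \<Omega>"
      and mean: "zero_average \<Omega>" and weak: "in_weak_Lp (real CARD('n) / \<alpha>) \<Omega>"
      and f: "smooth_compact_support f"
    define p where "p = real CARD('n) / \<alpha>"
    define N where "N = enn2real (weak_Lp_norm p \<Omega>)"
    have p: "0 < p" using \<alpha> by (simp add: p_def)
    have weak': "in_weak_Lp p \<Omega>" using weak by (simp add: p_def)
    then have \<Omega>: "\<Omega> \<in> borel_measurable sphere_measure" by (simp add: in_weak_Lp_def)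
    have N: "weak_Lp_norm p \<Omega> = ennreal N" "0 \<le> N"
      using weak' by (simp_all add: N_def in_weak_Lp_def)
    obtain \<Theta> where \<Theta> [measurable]: "\<Theta> \<in> borel_measurable borel" and hom': "homogeneous_deg0 \<Theta>"
      and ae: "AE y in lebesgue. \<Omega> y = \<Theta> y" and ae': "AE \<theta> in sphere_measure. \<Omega> \<theta> = \<Theta> \<theta>"
      using homogeneous_Borel_version[OF \<Omega> hom] by blast
    have "(LINT \<theta>|sphere_measure. \<Theta> \<theta>) = (LINT \<theta>|sphere_measure. \<Omega> \<theta>)"
      using ae' by (intro integral_cong_AE \<Omega> measurable_sphere_measure \<Theta>) (auto elim: eventually_mono)
    then have mean': "(LINT y:ball 0 1|lborel. \<Theta> y) = 0"
      using mean integral_sphere_measure[OF \<Theta> hom'] by (simp add: zero_average_def)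
    interpret rough_kernel \<Theta> \<alpha> N
    proof
      show "emeasure lborel {y \<in> ball 0 1. u < \<bar>\<Theta> y\<bar>}
          \<le> ennreal ((N / u) powr (real DIM(real^'n) / \<alpha>) / real DIM(real^'n))" if "0 < u" for u
        using emeasure_level_le_weak_norm[OF p weak' \<Theta> hom' ae' that] by (simp add: N_def p_def)
    qed (use assms \<alpha> N hom' mean' in auto)
    obtain M R where cont: "continuous_on UNIV f" and M: "\<And>y. \<bar>f y\<bar> \<le> M"
      and R: "\<And>y. R \<le> norm y \<Longrightarrow> f y = 0"
      using smooth_compact_support_bounds[OF f] by blast
    have f_meas [measurable]: "f \<in> borel_measurable borel"
      using cont by (rule borel_measurable_continuous_onI)
    let ?T = "T_weight w \<alpha> (frac_diff \<alpha> f) x"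
    have \<Omega>_meas: "\<Omega> \<in> borel_measurable lebesgue"
      by (rule borel_measurable_AE[of \<Theta>]) (use ae in \<open>auto intro: measurable_completion elim: eventually_mono\<close>)
    have "ennreal \<bar>LINT y:{y. norm y > t}|lebesgue. \<Omega> y / norm y ^ DIM(real^'n) * f (x - y)\<bar>
        \<le> ennreal (?c * (1 - \<alpha>)) * ennreal N * ennreal (A1_const w) * ?T" if t: "0 < t" for t
    proof -
      have "(LINT y:{y. norm y > t}|lebesgue. \<Omega> y / norm y ^ DIM(real^'n) * f (x - y))
          = (LINT y:{y. norm y > t}|lebesgue. \<Theta> y / norm y ^ DIM(real^'n) * f (x - y))"
        unfolding set_lebesgue_integral_def
      proof (rule integral_cong_AE)
        have k: "(\<lambda>y. indicat_real {y. norm y > t} y * (1 / norm y ^ DIM(real^'n) * f (x - y)))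
            \<in> borel_measurable lebesgue"
          by (rule measurable_completion) measurable
        from borel_measurable_times[OF \<Omega>_meas k]
        show "(\<lambda>y. indicat_real {y. norm y > t} y *\<^sub>R (\<Omega> y / norm y ^ DIM(real^'n) * f (x - y)))
            \<in> borel_measurable lebesgue" by (simp add: mult_ac)
        show "(\<lambda>y. indicat_real {y. norm y > t} y *\<^sub>R (\<Theta> y / norm y ^ DIM(real^'n) * f (x - y)))
            \<in> borel_measurable lebesgue"
          by (rule measurable_completion) measurable
        show "AE y in lebesgue. indicat_real {y. norm y > t} y *\<^sub>R (\<Omega> y / norm y ^ DIM(real^'n) * f (x - y))
            = indicat_real {y. norm y > t} y *\<^sub>R (\<Theta> y / norm y ^ DIM(real^'n) * f (x - y))"
          using ae by eventually_elim simp
      qed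
      also have "\<dots> = (LINT y:{y. norm y > t}|lborel. \<Theta> y / norm y ^ DIM(real^'n) * f (x - y))"
        unfolding set_lebesgue_integral_def by (rule integral_completion) measurable
      finally have "ennreal \<bar>LINT y:{y. norm y > t}|lebesgue. \<Omega> y / norm y ^ DIM(real^'n) * f (x - y)\<bar>
          = ennreal \<bar>LINT y:{y. norm y > t}|lborel. \<Theta> y / norm y ^ DIM(real^'n) * f (x - y)\<bar>"
        by simp
      also have "\<dots> \<le> ennreal (4 * 3 ^ DIM(real^'n) * isoperimetric_const TYPE(real^'n) * (1 - \<alpha>) * N) *
          (\<integral>\<^sup>+y. ennreal (norm y powr (\<alpha> - real DIM(real^'n))) * frac_diff \<alpha> (\<lambda>y. f (x - y)) y \<partial>lborel)"
      proof (rule abs_truncated_integral_le_riesz_potential)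
        show "f (x - y) = 0" if "norm x + R \<le> norm y" for y
          using that norm_triangle_ineq2[of y x] by (intro R) (simp add: norm_minus_commute)
      qed (use M t in auto)
      also have "(\<integral>\<^sup>+y. ennreal (norm y powr (\<alpha> - real DIM(real^'n))) * frac_diff \<alpha> (\<lambda>y. f (x - y)) y \<partial>lborel)
          = (\<integral>\<^sup>+y. ennreal (norm (x - (x - y)) powr (\<alpha> - real DIM(real^'n))) * frac_diff \<alpha> f (x - y) \<partial>lborel)"
        by (simp add: frac_diff_reflect)
      also have "\<dots> = (\<integral>\<^sup>+y. ennreal (norm (x - y) powr (\<alpha> - real DIM(real^'n))) * frac_diff \<alpha> f y \<partial>lborel)"
        by (rule nn_integral_lborel_reflect) measurable
      also have "\<dots> \<le> ennreal (A1_const w * unit_ball_vol (real DIM(real^'n))) * ?T"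
        by (rule riesz_potential_le_T_weight[OF A1]) measurable
      finally have "ennreal \<bar>LINT y:{y. norm y > t}|lebesgue. \<Omega> y / norm y ^ DIM(real^'n) * f (x - y)\<bar>
        \<le> ennreal (?\<kappa> * (1 - \<alpha>) * N) * (ennreal (A1_const w * unit_ball_vol (real CARD('n))) * ?T)"
        by (simp add: mult_left_mono)
      also have "\<dots> = ennreal (?c * (1 - \<alpha>)) * ennreal N * ennreal (A1_const w) * ?T"
      proof -
        have "0 \<le> A1_const w"
          using A1_bound_pos[of w "A1_const w"] A1_const_least(1)[OF A1] A1 by (simp add: A1_weight_def)
        then have nonneg: "0 \<le> A1_const w * unit_ball_vol (real CARD('n))" "0 \<le> ?\<kappa> * (1 - \<alpha>) * N"
            "0 \<le> ?c * (1 - \<alpha>)" "0 \<le> ?c * (1 - \<alpha>) * N" "0 \<le> A1_const w"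
          using \<alpha> N less_imp_le[OF iso] by (auto intro!: mult_nonneg_nonneg)
        have "ennreal (?\<kappa> * (1 - \<alpha>) * N) * ennreal (A1_const w * unit_ball_vol (real CARD('n)))
            = ennreal (?c * (1 - \<alpha>) * N * A1_const w)"
          by (subst ennreal_mult[OF nonneg(2,1), symmetric]) (simp only: mult_ac)
        also have "\<dots> = ennreal (?c * (1 - \<alpha>)) * ennreal N * ennreal (A1_const w)"
          by (simp only: ennreal_mult[OF nonneg(4,5)] ennreal_mult[OF nonneg(3) N(2)])
        finally have "ennreal (?\<kappa> * (1 - \<alpha>) * N) * ennreal (A1_const w * unit_ball_vol (real CARD('n)))
            = ennreal (?c * (1 - \<alpha>)) * ennreal N * ennreal (A1_const w)" .
        then show ?thesis by (simp only: mult.assoc[symmetric])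
      qed
      finally show ?thesis .
    qed
    then show "T_star \<Omega> f x \<le> ennreal (?c * (1 - \<alpha>)) * weak_Lp_norm (real CARD('n) / \<alpha>) \<Omega> *
        ennreal (A1_const w) * ?T"
      unfolding T_star_def p_def[symmetric] N(1) by (intro SUP_least) simp
  qed
qed

end
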